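(* In $\mathbf{ZF}$, AMC implies that every algebraic theory has free algebras (that is, for every algebraic theory and every set $G$ there is a free algebra of the theory on the set $G$ of generators).
   Context: In $\mathbf{ZF}$, AMC is the following statement: for every set $X$ there is a set of surjections $\{p_i:Y_i\to X \mid i\in I\}$ onto $X$ such that for every surjection $q:Z\to X$ there are $i\in I$ and a function $f:Y_i\to Z$ with $p_i=q\circ f$. Algebraic theories are allowed to be infinitary: an algebraic theory is given by a set of operation symbols, each with an arity which is a (possibly infinite) set, together with a set of equations between terms. *)

theory Defs
  imports Main
begin

text \<open>
  HOL itself satisfies the axiom of choice, so a theorem of ZF cannot be stated about the sets or
  types of HOL. It is stated here as a theorem about every first-order structure for the language
  of set theory, that is, a type \<open>'v\<close> with a binary relation, in which the axioms of ZF hold.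
  Below, every quantifier occurring in a set-theoretic notion ranges over \<open>'v\<close> (never over
  functions or sets on \<open>'v\<close>), so each notion is a first-order formula in membership and equality.
\<close>

datatype fm =
    Mem nat nat
  | Equ nat nat
  | Neg fm
  | Conj fm fm
  | Forall nat fm

locale set_universe =
  fixes mem :: "'v \<Rightarrow> 'v \<Rightarrow> bool"  (infix "\<^bold>\<in>" 50)
begin

primrec sat :: "(nat \<Rightarrow> 'v) \<Rightarrow> fm \<Rightarrow> bool" where
  "sat e (Mem i j) \<longleftrightarrow> e i \<^bold>\<in> e j"
| "sat e (Equ i j) \<longleftrightarrow> e i = e j"
| "sat e (Neg \<phi>) \<longleftrightarrow> \<not> sat e \<phi>"
| "sat e (Conj \<phi> \<psi>) \<longleftrightarrow> sat e \<phi> \<and> sat e \<psi>"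
| "sat e (Forall i \<phi>) \<longleftrightarrow> (\<forall>x. sat (e(i := x)) \<phi>)"

definition is_empty :: "'v \<Rightarrow> bool" where
  "is_empty z \<longleftrightarrow> (\<forall>w. \<not> w \<^bold>\<in> z)"

definition is_upair :: "'v \<Rightarrow> 'v \<Rightarrow> 'v \<Rightarrow> bool" where
  "is_upair u a b \<longleftrightarrow> (\<forall>w. w \<^bold>\<in> u \<longleftrightarrow> w = a \<or> w = b)"

definition subset :: "'v \<Rightarrow> 'v \<Rightarrow> bool" where
  "subset x y \<longleftrightarrow> (\<forall>w. w \<^bold>\<in> x \<longrightarrow> w \<^bold>\<in> y)"

text \<open>Kuratowski pairs.\<close>

definition is_pair :: "'v \<Rightarrow> 'v \<Rightarrow> 'v \<Rightarrow> bool" where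
  "is_pair p a b \<longleftrightarrow> (\<exists>s d. is_upair s a a \<and> is_upair d a b \<and> is_upair p s d)"

text \<open>\<open>maps f x y\<close> says that \<open>f\<close>, as a set of pairs, sends \<open>x\<close> to \<open>y\<close>.\<close>

definition maps :: "'v \<Rightarrow> 'v \<Rightarrow> 'v \<Rightarrow> bool" where
  "maps f x y \<longleftrightarrow> (\<exists>p. is_pair p x y \<and> p \<^bold>\<in> f)"

definition is_fun :: "'v \<Rightarrow> 'v \<Rightarrow> 'v \<Rightarrow> bool" where
  "is_fun f A B \<longleftrightarrow>
     (\<forall>p. p \<^bold>\<in> f \<longrightarrow> (\<exists>x y. x \<^bold>\<in> A \<and> y \<^bold>\<in> B \<and> is_pair p x y)) \<and>
     (\<forall>x. x \<^bold>\<in> A \<longrightarrow> (\<exists>!y. maps f x y))"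

definition is_surj :: "'v \<Rightarrow> 'v \<Rightarrow> 'v \<Rightarrow> bool" where
  "is_surj f A B \<longleftrightarrow> is_fun f A B \<and> (\<forall>y. y \<^bold>\<in> B \<longrightarrow> (\<exists>x. x \<^bold>\<in> A \<and> maps f x y))"

text \<open>\<open>is_comp h g f\<close>: the set \<open>h\<close> is the composite of \<open>f\<close> followed by \<open>g\<close>.\<close>

definition is_comp :: "'v \<Rightarrow> 'v \<Rightarrow> 'v \<Rightarrow> bool" where
  "is_comp h g f \<longleftrightarrow>
     (\<forall>p. p \<^bold>\<in> h \<longleftrightarrow> (\<exists>x y z. maps f x y \<and> maps g y z \<and> is_pair p x z))"

definition is_funset :: "'v \<Rightarrow> 'v \<Rightarrow> 'v \<Rightarrow> bool" where
  "is_funset K A B \<longleftrightarrow> (\<forall>f. f \<^bold>\<in> K \<longleftrightarrow> is_fun f A B)"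

text \<open>
  A set of surjections onto \<open>X\<close> is a set \<open>P\<close> (indexed by itself); the domain of a member of \<open>P\<close> is
  determined by that member.
\<close>

definition AMC :: bool where
  "AMC \<longleftrightarrow> (\<forall>X. \<exists>P.
     (\<forall>p. p \<^bold>\<in> P \<longrightarrow> (\<exists>Y. is_surj p Y X)) \<and>
     (\<forall>Z q. is_surj q Z X \<longrightarrow>
        (\<exists>p Y f. p \<^bold>\<in> P \<and> is_surj p Y X \<and> is_fun f Y Z \<and> is_comp p q f)))"

text \<open>
  A signature is a set \<open>Op\<close> of operation symbols with a function \<open>Ar\<close> on \<open>Op\<close> whose values, the
  arities, are arbitrary sets. Terms are coded as nested pairs: the variable \<open>v\<close> is \<open>(0, v)\<close>, and
  the symbol \<open>\<sigma>\<close> applied to the family \<open>f\<close> of terms indexed by the arity of \<open>\<sigma>\<close> is \<open>(1, (\<sigma>, f))\<close>.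
\<close>

definition is_signature :: "'v \<Rightarrow> 'v \<Rightarrow> bool" where
  "is_signature Op Ar \<longleftrightarrow> (\<exists>C. is_fun Ar Op C)"

definition is_var :: "'v \<Rightarrow> 'v \<Rightarrow> bool" where
  "is_var t v \<longleftrightarrow> (\<exists>z. is_empty z \<and> is_pair t z v)"

definition is_optm :: "'v \<Rightarrow> 'v \<Rightarrow> 'v \<Rightarrow> bool" where
  "is_optm t \<sigma> f \<longleftrightarrow>
     (\<exists>z u q. is_empty z \<and> is_upair u z z \<and> is_pair q \<sigma> f \<and> is_pair t u q)"

definition term_closed :: "'v \<Rightarrow> 'v \<Rightarrow> 'v \<Rightarrow> 'v \<Rightarrow> bool" where
  "term_closed Op Ar V T \<longleftrightarrow>
     (\<forall>v t. v \<^bold>\<in> V \<and> is_var t v \<longrightarrow> t \<^bold>\<in> T) \<and>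
     (\<forall>\<sigma> a f t. \<sigma> \<^bold>\<in> Op \<and> maps Ar \<sigma> a \<and> is_fun f a T \<and> is_optm t \<sigma> f \<longrightarrow> t \<^bold>\<in> T)"

text \<open>
  The terms in the variables \<open>V\<close> form the least set closed under term formation. ZF proves (without
  choice) that it exists, so asking for it below is no restriction.
\<close>

definition is_term_set :: "'v \<Rightarrow> 'v \<Rightarrow> 'v \<Rightarrow> 'v \<Rightarrow> bool" where
  "is_term_set Op Ar V T \<longleftrightarrow>
     term_closed Op Ar V T \<and> (\<forall>T'. term_closed Op Ar V T' \<longrightarrow> subset T T')"

text \<open>An equation is a triple \<open>(V, (s, t))\<close> of a set \<open>V\<close> of variables and two terms over \<open>V\<close>.\<close>

definition is_eqn :: "'v \<Rightarrow> 'v \<Rightarrow> 'v \<Rightarrow> 'v \<Rightarrow> bool" where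
  "is_eqn e V s t \<longleftrightarrow> (\<exists>q. is_pair q s t \<and> is_pair e V q)"

definition is_theory :: "'v \<Rightarrow> 'v \<Rightarrow> 'v \<Rightarrow> bool" where
  "is_theory Op Ar Eqs \<longleftrightarrow>
     is_signature Op Ar \<and>
     (\<forall>e. e \<^bold>\<in> Eqs \<longrightarrow>
        (\<exists>V s t T. is_eqn e V s t \<and> is_term_set Op Ar V T \<and> s \<^bold>\<in> T \<and> t \<^bold>\<in> T))"

text \<open>
  \<open>F\<close> assigns to each \<open>\<sigma>\<close> in \<open>Op\<close> an operation from the set of functions from the arity of \<open>\<sigma>\<close> to
  \<open>M\<close>, into \<open>M\<close>.
\<close>

definition is_structure :: "'v \<Rightarrow> 'v \<Rightarrow> 'v \<Rightarrow> 'v \<Rightarrow> bool" where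
  "is_structure Op Ar M F \<longleftrightarrow>
     (\<exists>C. is_fun F Op C) \<and>
     (\<forall>\<sigma> a. \<sigma> \<^bold>\<in> Op \<and> maps Ar \<sigma> a \<longrightarrow>
        (\<exists>g K. maps F \<sigma> g \<and> is_funset K a M \<and> is_fun g K M))"

text \<open>\<open>ev\<close> evaluates the terms over \<open>V\<close> (the set \<open>T\<close>) in \<open>(M, F)\<close> under the assignment \<open>\<rho>\<close>.\<close>

definition is_eval :: "'v \<Rightarrow> 'v \<Rightarrow> 'v \<Rightarrow> 'v \<Rightarrow> 'v \<Rightarrow> 'v \<Rightarrow> 'v \<Rightarrow> 'v \<Rightarrow> bool" where
  "is_eval Op Ar M F V T \<rho> ev \<longleftrightarrow>
     is_fun ev T M \<and>
     (\<forall>v t. v \<^bold>\<in> V \<and> is_var t v \<longrightarrow> (\<exists>m. maps \<rho> v m \<and> maps ev t m)) \<and>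
     (\<forall>\<sigma> a f t. \<sigma> \<^bold>\<in> Op \<and> maps Ar \<sigma> a \<and> is_fun f a T \<and> is_optm t \<sigma> f \<longrightarrow>
        (\<exists>g h m. maps F \<sigma> g \<and> is_comp h ev f \<and> maps g h m \<and> maps ev t m))"

definition satisfies_eqn :: "'v \<Rightarrow> 'v \<Rightarrow> 'v \<Rightarrow> 'v \<Rightarrow> 'v \<Rightarrow> 'v \<Rightarrow> 'v \<Rightarrow> bool" where
  "satisfies_eqn Op Ar M F V s t \<longleftrightarrow>
     (\<forall>T \<rho>. is_term_set Op Ar V T \<and> is_fun \<rho> V M \<longrightarrow>
        (\<exists>ev m. is_eval Op Ar M F V T \<rho> ev \<and> maps ev s m \<and> maps ev t m))"

definition is_algebra :: "'v \<Rightarrow> 'v \<Rightarrow> 'v \<Rightarrow> 'v \<Rightarrow> 'v \<Rightarrow> bool" where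
  "is_algebra Op Ar Eqs M F \<longleftrightarrow>
     is_structure Op Ar M F \<and>
     (\<forall>e V s t. e \<^bold>\<in> Eqs \<and> is_eqn e V s t \<longrightarrow> satisfies_eqn Op Ar M F V s t)"

definition is_hom :: "'v \<Rightarrow> 'v \<Rightarrow> 'v \<Rightarrow> 'v \<Rightarrow> 'v \<Rightarrow> 'v \<Rightarrow> 'v \<Rightarrow> bool" where
  "is_hom Op Ar M F N H h \<longleftrightarrow>
     is_fun h M N \<and>
     (\<forall>\<sigma> a x. \<sigma> \<^bold>\<in> Op \<and> maps Ar \<sigma> a \<and> is_fun x a M \<longrightarrow>
        (\<exists>k l y m n. maps F \<sigma> k \<and> maps H \<sigma> l \<and> is_comp y h x \<and>
           maps k x m \<and> maps l y n \<and> maps h m n))"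

definition is_free_algebra :: "'v \<Rightarrow> 'v \<Rightarrow> 'v \<Rightarrow> 'v \<Rightarrow> 'v \<Rightarrow> 'v \<Rightarrow> 'v \<Rightarrow> bool" where
  "is_free_algebra Op Ar Eqs G M F \<eta> \<longleftrightarrow>
     is_algebra Op Ar Eqs M F \<and> is_fun \<eta> G M \<and>
     (\<forall>N H g. is_algebra Op Ar Eqs N H \<and> is_fun g G N \<longrightarrow>
        (\<exists>!h. is_hom Op Ar M F N H h \<and> is_comp g h \<eta>))"

end

text \<open>
  In the two schemas \<open>e\<close> supplies the parameters of \<open>\<phi>\<close>; variable 0 (in replacement, variables 0
  and 1) is the distinguished one. They range over first-order formulas only: with arbitrary HOL
  predicates in their place, choice in HOL would force choice in the structure.
\<close>

locale ZF_model = set_universe +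
  assumes extensionality: "\<forall>w. w \<^bold>\<in> x \<longleftrightarrow> w \<^bold>\<in> y \<Longrightarrow> x = y"
    and foundation: "\<exists>y. y \<^bold>\<in> x \<Longrightarrow> \<exists>y. y \<^bold>\<in> x \<and> (\<forall>z. z \<^bold>\<in> y \<longrightarrow> \<not> z \<^bold>\<in> x)"
    and pairing: "\<exists>u. is_upair u x y"
    and union: "\<exists>u. \<forall>w. w \<^bold>\<in> u \<longleftrightarrow> (\<exists>y. y \<^bold>\<in> x \<and> w \<^bold>\<in> y)"
    and powerset: "\<exists>u. \<forall>w. w \<^bold>\<in> u \<longleftrightarrow> subset w x"
    and infinity: "\<exists>x. (\<exists>z. is_empty z \<and> z \<^bold>\<in> x) \<and>
      (\<forall>y. y \<^bold>\<in> x \<longrightarrow> (\<exists>s. s \<^bold>\<in> x \<and> (\<forall>w. w \<^bold>\<in> s \<longleftrightarrow> w \<^bold>\<in> y \<or> w = y)))"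
    and separation: "\<exists>u. \<forall>w. w \<^bold>\<in> u \<longleftrightarrow> w \<^bold>\<in> x \<and> sat (e(0 := w)) \<phi>"
    and replacement:
      "(\<And>y v v'. y \<^bold>\<in> x \<Longrightarrow> sat (e(0 := y, 1 := v)) \<phi> \<Longrightarrow> sat (e(0 := y, 1 := v')) \<phi> \<Longrightarrow> v = v') \<Longrightarrow>
       \<exists>u. \<forall>v. v \<^bold>\<in> u \<longleftrightarrow> (\<exists>y. y \<^bold>\<in> x \<and> sat (e(0 := y, 1 := v)) \<phi>)"

end

theory Submission imports Defs
begin

text \<open>
  Applied to the disjoint union of the arities, AMC yields a set \<open>P\<close> of covers. An operation whose
  arguments are indexed by a cover of its arity, rather than by the arity itself, can be applied to
  a family of equivalence classes without choosing representatives, since some cover admits a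
  lift of the family to representatives. So consider terms over these covering arities, coded in a
  set \<open>B\<close>. Such a term has a value in an algebra only if the values of its arguments agree on the
  fibres of the cover. The terms with a value in every algebra under the generators, identified when
  they always have the same value, form the free algebra: by AMC it is closed under the operations,
  its homomorphisms to the other algebras are given by evaluation, these jointly separate points,
  and so the equations are inherited from the other algebras.

  All of this takes place inside the model, so every comprehension needs a proof that the predicate
  is first-order definable.
\<close>

text \<open>Dividing the ordinary term algebra by the equations is obstructed: applying an
  infinitary operation to classes would require representatives of all arguments at once. With a
  cover as index set, several points may lie over one argument position and carry different
  representatives of the same class, so agreement on fibres can only be demanded of values, not of
  codes. Hence evaluation is a partial relation, and a code counts as well formed when it has a
  value everywhere. This condition quantifies over a proper class of algebras, yet it is a
  first-order formula, so separation cuts a set out of \<open>B\<close>; and \<open>B\<close> is a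
  set because AMC supplies a set of covers. Uniqueness of homomorphisms needs the classes to be
  generated by \<open>G\<close>: if a code has a value everywhere, so do its arguments, and those on
  one fibre lie in one class, so the class of the code is the operation applied to these classes.
  Elsewhere choice is avoided because the objects to be collected (values, classes, operations) are
  unique.\<close>

section \<open>Definability\<close>

primrec rename :: "(nat \<Rightarrow> nat) \<Rightarrow> fm \<Rightarrow> fm" where
  "rename r (Mem i j) = Mem (r i) (r j)"
| "rename r (Equ i j) = Equ (r i) (r j)"
| "rename r (Neg \<phi>) = Neg (rename r \<phi>)"
| "rename r (Conj \<phi> \<psi>) = Conj (rename r \<phi>) (rename r \<psi>)"
| "rename r (Forall i \<phi>) = Forall (r i) (rename r \<phi>)"

text \<open>Both sequences keep infinitely many slots, so parameters can be added or merged without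
  counting the variables of a formula.\<close>

definition interleave :: "(nat \<Rightarrow> 'a) \<Rightarrow> (nat \<Rightarrow> 'a) \<Rightarrow> nat \<Rightarrow> 'a" where
  "interleave e c i = (if even i then e (i div 2) else c (i div 2))"

context set_universe
begin

text \<open>Bound variables are renamed as well; injectivity of \<open>r\<close> keeps a renamed
  binder from capturing another variable.\<close>

lemma sat_rename: "inj r \<Longrightarrow> sat e (rename r \<phi>) \<longleftrightarrow> sat (\<lambda>i. e (r i)) \<phi>"
proof (induction \<phi> arbitrary: e)
  case (Forall i \<phi>)
  have "(\<lambda>j. (e(r i := x)) (r j)) = (\<lambda>j. e (r j))(i := x)" for x
    using Forall.prems by (auto simp: inj_eq)
  then show ?case using Forall by simp
qed auto

text \<open>
  Definability from parameters, for predicates of an environment: the even variables of a formula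
  read the environment, the odd ones read the parameters. Binders use de Bruijn indices.
\<close>

definition dfn :: "((nat \<Rightarrow> 'v) \<Rightarrow> bool) \<Rightarrow> bool" where
  "dfn P \<longleftrightarrow> (\<exists>\<phi> c. \<forall>e. P e \<longleftrightarrow> sat (interleave e c) \<phi>)"

text \<open>The language has no function symbols, so a term is represented by its graph: slot 0
  holds the value and the environment read by \<open>t\<close> moves up by one.\<close>

definition dft :: "((nat \<Rightarrow> 'v) \<Rightarrow> 'v) \<Rightarrow> bool" where
  "dft t \<longleftrightarrow> dfn (\<lambda>e. e 0 = t (\<lambda>n. e (Suc n)))"

lemma dfn_not: "dfn P \<Longrightarrow> dfn (\<lambda>e. \<not> P e)"
  unfolding dfn_def by (elim exE, rule_tac x = "Neg \<phi>" in exI) auto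

lemma dfn_conj:
  assumes "dfn P" "dfn Q"
  shows "dfn (\<lambda>e. P e \<and> Q e)"
proof -
  obtain \<phi> c \<psi> d where P: "\<And>e. P e \<longleftrightarrow> sat (interleave e c) \<phi>"
    and Q: "\<And>e. Q e \<longleftrightarrow> sat (interleave e d) \<psi>"
    using assms unfolding dfn_def by blast
  \<comment> \<open>The two parameter sequences are merged by interleaving them in turn: environment
    slots stay, and parameter \<open>j\<close> of sequence \<open>k\<close> becomes parameter
    \<open>2 * j + k\<close>.\<close>
  define r where "r k i = (if even i then i else 2 * (2 * (i div 2) + k) + 1)" for k i :: nat
  have "inj (r k)" for k
    by (rule injI) (auto simp: r_def split: if_splits elim!: oddE)
  moreover have "(\<lambda>i. interleave e (interleave c d) (r 0 i)) = interleave e c"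
    "(\<lambda>i. interleave e (interleave c d) (r 1 i)) = interleave e d" for e
    by (auto simp: fun_eq_iff interleave_def r_def elim!: oddE)
  ultimately have "P e \<and> Q e \<longleftrightarrow>
      sat (interleave e (interleave c d)) (Conj (rename (r 0) \<phi>) (rename (r 1) \<psi>))" for e
    by (simp add: P Q sat_rename)
  then show ?thesis unfolding dfn_def by blast
qed

lemma dfn_rename:
  assumes "dfn P" "inj r"
  shows "dfn (\<lambda>e. P (\<lambda>n. e (r n)))"
proof -
  obtain \<phi> c where P: "\<And>e. P e \<longleftrightarrow> sat (interleave e c) \<phi>"
    using assms unfolding dfn_def by blast
  define r' where "r' i = (if even i then 2 * r (i div 2) else i)" for i :: nat
  have "inj r'"
  proof (rule injI)
    fix i j assume *: "r' i = r' j"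
    then have "even i = even j" by (auto simp: r'_def split: if_splits)
    with * show "i = j"
      using injD[OF assms(2), of "i div 2" "j div 2"] by (auto simp: r'_def split: if_splits)
  qed
  moreover have "(\<lambda>i. interleave e c (r' i)) = interleave (\<lambda>n. e (r n)) c" for e
    by (auto simp: fun_eq_iff interleave_def r'_def)
  ultimately have "P (\<lambda>n. e (r n)) \<longleftrightarrow> sat (interleave e c) (rename r' \<phi>)" for e
    by (simp add: P sat_rename)
  then show ?thesis unfolding dfn_def by blast
qed

lemma dfn_all:
  assumes "dfn (\<lambda>e. Q (\<lambda>n. e (Suc n)) (e 0))"
  shows "dfn (\<lambda>e. \<forall>x. Q e x)"
proof -
  obtain \<phi> c where \<phi>: "\<And>e. Q (\<lambda>n. e (Suc n)) (e 0) \<longleftrightarrow> sat (interleave e c) \<phi>"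
    using assms unfolding dfn_def by blast
  \<comment> \<open>Environment slot 0 of the body becomes the bound variable, and the other
    environment slots move down to fill all even positions. The binder therefore takes the odd
    variable 1, freed by moving every parameter up one place; the \<open>undefined\<close> put there
    is always overwritten.\<close>
  define r where "r i = (if i = 0 then 1 else if even i then i - 2 else i + 2)" for i :: nat
  define c' where "c' = case_nat undefined c"
  have "inj r"
    by (rule injI) (auto simp: r_def split: if_splits elim!: evenE; presburger)
  moreover have "(\<lambda>i. ((interleave e c')(1 := x)) (r i)) = interleave (case_nat x e) c" for e x
  proof
    fix i
    consider "i = 0" | j where "i = 2 * Suc j" | j where "i = 2 * j + 1"
      by (metis evenE not0_implies_Suc mult_0_right oddE)
    then show "((interleave e c')(1 := x)) (r i) = interleave (case_nat x e) c i"
      by cases (auto simp: interleave_def r_def c'_def)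
  qed
  moreover have "Q e x \<longleftrightarrow> sat (interleave (case_nat x e) c) \<phi>" for e x
    using \<phi>[of "case_nat x e"] by simp
  ultimately have "(\<forall>x. Q e x) \<longleftrightarrow> sat (interleave e c') (Forall 1 (rename r \<phi>))" for e
    by (simp add: sat_rename del: fun_upd_apply)
  then show ?thesis unfolding dfn_def by blast
qed

lemma dfn_ex:
  assumes "dfn (\<lambda>e. Q (\<lambda>n. e (Suc n)) (e 0))"
  shows "dfn (\<lambda>e. \<exists>x. Q e x)"
proof -
  have "dfn (\<lambda>e. \<not> (\<forall>x. \<not> Q e x))"
    by (rule dfn_not, rule dfn_all, rule dfn_not, rule assms)
  then show ?thesis by simp
qed

lemma dfn_imp:
  assumes "dfn P" "dfn Q"
  shows "dfn (\<lambda>e. P e \<longrightarrow> Q e)"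
proof -
  have "dfn (\<lambda>e. \<not> (P e \<and> \<not> Q e))"
    by (rule dfn_not, rule dfn_conj, rule assms, rule dfn_not, rule assms)
  then show ?thesis by simp
qed

lemma dfn_disj:
  assumes "dfn P" "dfn Q"
  shows "dfn (\<lambda>e. P e \<or> Q e)"
proof -
  have "dfn (\<lambda>e. \<not> P e \<longrightarrow> Q e)"
    by (rule dfn_imp, rule dfn_not, (rule assms)+)
  then show ?thesis by (simp add: disj_imp)
qed

lemma dfn_iff:
  assumes "dfn P" "dfn Q"
  shows "dfn (\<lambda>e. P e \<longleftrightarrow> Q e)"
proof -
  have "dfn (\<lambda>e. (P e \<longrightarrow> Q e) \<and> (Q e \<longrightarrow> P e))"
    by (rule dfn_conj; rule dfn_imp; rule assms)
  then show ?thesis by (simp add: iff_conv_conj_imp)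
qed

lemma dft_var: "dft (\<lambda>e. e i)"
  unfolding dft_def dfn_def
  by (rule exI[of _ "Equ 0 (2 * Suc i)"]) (simp add: interleave_def)

lemma dft_const: "dft (\<lambda>e. a)"
  unfolding dft_def dfn_def
  by (rule exI[of _ "Equ 0 1"], rule exI[of _ "\<lambda>_. a"]) (simp add: interleave_def)

lemma dfn_mem_var: "dfn (\<lambda>e. e i \<^bold>\<in> e j)"
  unfolding dfn_def by (rule exI[of _ "Mem (2 * i) (2 * j)"]) (simp add: interleave_def)

lemma dfn_eq_var: "dfn (\<lambda>e. e i = e j)"
  unfolding dfn_def by (rule exI[of _ "Equ (2 * i) (2 * j)"]) (simp add: interleave_def)

lemma dft_shift:
  assumes "dft t"
  shows "dft (\<lambda>e. t (\<lambda>n. e (Suc n)))"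
proof -
  \<comment> \<open>Slot 0, the value in the graph of \<open>t\<close>, stays; slot 1, the newly
    bound variable, is skipped.\<close>
  have "inj (case_nat 0 (\<lambda>n. Suc (Suc n)))"
    by (auto simp: inj_def split: nat.splits)
  from dfn_rename[OF assms[unfolded dft_def] this] show ?thesis
    unfolding dft_def by simp
qed

lemma dfn_subst:
  assumes "dft t" "dfn (\<lambda>e. Q (\<lambda>n. e (Suc n)) (e 0))"
  shows "dfn (\<lambda>e. Q e (t e))"
proof -
  have "dfn (\<lambda>e. \<exists>x. x = t e \<and> Q e x)"
    by (intro dfn_ex dfn_conj assms(1)[unfolded dft_def] assms(2))
  then show ?thesis by simp
qed

lemma dfn_mem:
  assumes "dft t" "dft u" shows "dfn (\<lambda>e. t e \<^bold>\<in> u e)"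
  by (rule dfn_subst[of t "\<lambda>e x. x \<^bold>\<in> u e"], rule assms,
      rule dfn_subst[of "\<lambda>e. u (\<lambda>n. e (Suc n))" "\<lambda>e x. e 0 \<^bold>\<in> x"], rule dft_shift, rule assms,
      rule dfn_mem_var)

lemma dfn_eq:
  assumes "dft t" "dft u" shows "dfn (\<lambda>e. t e = u e)"
  by (rule dfn_subst[of t "\<lambda>e x. x = u e"], rule assms,
      rule dfn_subst[of "\<lambda>e. u (\<lambda>n. e (Suc n))" "\<lambda>e x. e 0 = x"], rule dft_shift, rule assms,
      rule dfn_eq_var)

lemma dfn_ex1:
  assumes "dfn (\<lambda>e. Q (\<lambda>n. e (Suc n)) (e 0))"
  shows "dfn (\<lambda>e. \<exists>!x. Q e x)"
proof -
  have "inj (case_nat 0 (\<lambda>n. Suc (Suc n)))"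
    by (auto simp: inj_def split: nat.splits)
  from dfn_rename[OF assms this] have "dfn (\<lambda>e. Q (\<lambda>n. e (Suc (Suc n))) (e 0))"
    by simp
  then show ?thesis unfolding Ex1_def
    by (intro dfn_ex dfn_conj assms dfn_all dfn_imp dfn_eq dft_var)
qed

lemmas dfn_logic = dfn_not dfn_conj dfn_disj dfn_imp dfn_iff dfn_all dfn_ex dfn_ex1 dfn_mem dfn_eq

lemmas dfn_rules = dft_var dft_const dfn_logic

section \<open>Definability of the set-theoretic and algebraic notions\<close>

lemma dfn_is_empty: "dft t \<Longrightarrow> dfn (\<lambda>e. is_empty (t e))"
  unfolding is_empty_def by (intro dfn_rules dft_shift)

lemma dfn_is_upair: "dft t \<Longrightarrow> dft u \<Longrightarrow> dft v \<Longrightarrow> dfn (\<lambda>e. is_upair (t e) (u e) (v e))"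
  unfolding is_upair_def by (intro dfn_rules dft_shift)

lemma dfn_subset: "dft t \<Longrightarrow> dft u \<Longrightarrow> dfn (\<lambda>e. subset (t e) (u e))"
  unfolding subset_def by (intro dfn_rules dft_shift)

lemma dfn_is_pair: "dft t \<Longrightarrow> dft u \<Longrightarrow> dft v \<Longrightarrow> dfn (\<lambda>e. is_pair (t e) (u e) (v e))"
  unfolding is_pair_def by (intro dfn_rules dfn_is_upair dft_shift)

lemma dfn_maps: "dft t \<Longrightarrow> dft u \<Longrightarrow> dft v \<Longrightarrow> dfn (\<lambda>e. maps (t e) (u e) (v e))"
  unfolding maps_def by (intro dfn_rules dfn_is_pair dft_shift)

lemma dfn_is_fun: "dft t \<Longrightarrow> dft u \<Longrightarrow> dft v \<Longrightarrow> dfn (\<lambda>e. is_fun (t e) (u e) (v e))"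
  unfolding is_fun_def by (intro dfn_rules dfn_is_pair dfn_maps dft_shift)

lemma dfn_is_surj: "dft t \<Longrightarrow> dft u \<Longrightarrow> dft v \<Longrightarrow> dfn (\<lambda>e. is_surj (t e) (u e) (v e))"
  unfolding is_surj_def by (intro dfn_rules dfn_is_fun dfn_maps dft_shift)

lemma dfn_is_comp: "dft t \<Longrightarrow> dft u \<Longrightarrow> dft v \<Longrightarrow> dfn (\<lambda>e. is_comp (t e) (u e) (v e))"
  unfolding is_comp_def by (intro dfn_rules dfn_is_pair dfn_maps dft_shift)

lemma dfn_is_funset: "dft t \<Longrightarrow> dft u \<Longrightarrow> dft v \<Longrightarrow> dfn (\<lambda>e. is_funset (t e) (u e) (v e))"
  unfolding is_funset_def by (intro dfn_rules dfn_is_fun dft_shift)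

lemma dfn_is_var: "dft t \<Longrightarrow> dft u \<Longrightarrow> dfn (\<lambda>e. is_var (t e) (u e))"
  unfolding is_var_def by (intro dfn_rules dfn_is_empty dfn_is_pair dft_shift)

lemma dfn_is_optm: "dft t \<Longrightarrow> dft u \<Longrightarrow> dft v \<Longrightarrow> dfn (\<lambda>e. is_optm (t e) (u e) (v e))"
  unfolding is_optm_def by (intro dfn_rules dfn_is_empty dfn_is_upair dfn_is_pair dft_shift)

lemmas dfn_basic = dfn_rules dfn_is_empty dfn_is_upair dfn_subset dfn_is_pair dfn_maps dfn_is_fun
  dfn_is_surj dfn_is_comp dfn_is_funset dfn_is_var dfn_is_optm

lemma dfn_term_closed:
  "\<lbrakk>dft t; dft u; dft v; dft w\<rbrakk> \<Longrightarrow> dfn (\<lambda>e. term_closed (t e) (u e) (v e) (w e))"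
  unfolding term_closed_def by (intro dfn_basic dft_shift)

lemma dfn_is_term_set:
  "\<lbrakk>dft t; dft u; dft v; dft w\<rbrakk> \<Longrightarrow> dfn (\<lambda>e. is_term_set (t e) (u e) (v e) (w e))"
  unfolding is_term_set_def by (intro dfn_basic dfn_term_closed dft_shift)

lemma dfn_is_eqn:
  "\<lbrakk>dft t; dft u; dft v; dft w\<rbrakk> \<Longrightarrow> dfn (\<lambda>e. is_eqn (t e) (u e) (v e) (w e))"
  unfolding is_eqn_def by (intro dfn_basic dft_shift)

lemma dfn_is_structure:
  "\<lbrakk>dft t; dft u; dft v; dft w\<rbrakk> \<Longrightarrow> dfn (\<lambda>e. is_structure (t e) (u e) (v e) (w e))"
  unfolding is_structure_def by (intro dfn_basic dft_shift)

lemma dfn_is_eval: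
  "\<lbrakk>dft a; dft b; dft c; dft d; dft t; dft u; dft v; dft w\<rbrakk> \<Longrightarrow>
    dfn (\<lambda>e. is_eval (a e) (b e) (c e) (d e) (t e) (u e) (v e) (w e))"
  unfolding is_eval_def by (intro dfn_basic dft_shift)

lemma dfn_satisfies_eqn:
  "\<lbrakk>dft a; dft b; dft c; dft d; dft t; dft u; dft v\<rbrakk> \<Longrightarrow>
    dfn (\<lambda>e. satisfies_eqn (a e) (b e) (c e) (d e) (t e) (u e) (v e))"
  unfolding satisfies_eqn_def by (intro dfn_basic dfn_is_term_set dfn_is_eval dft_shift)

lemma dfn_is_algebra:
  "\<lbrakk>dft a; dft b; dft c; dft d; dft t\<rbrakk> \<Longrightarrow>
    dfn (\<lambda>e. is_algebra (a e) (b e) (c e) (d e) (t e))"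
  unfolding is_algebra_def
  by (intro dfn_basic dfn_is_structure dfn_satisfies_eqn dfn_is_eqn dft_shift)

end

section \<open>Set theory in the model\<close>

context ZF_model
begin

lemma sep_ex:
  assumes "dfn (\<lambda>e. P (e 0))"
  obtains u where "\<And>w. w \<^bold>\<in> u \<longleftrightarrow> w \<^bold>\<in> x \<and> P w"
proof -
  obtain \<phi> c where \<phi>: "\<And>e. P (e 0) \<longleftrightarrow> sat (interleave e c) \<phi>"
    using assms unfolding dfn_def by blast
  \<comment> \<open>\<open>P\<close> reads slot 0 only, so the rest of the environment is arbitrary;
    the parameters sit in the odd slots.\<close>
  let ?e = "\<lambda>_. undefined"
  obtain u where u: "\<And>w. w \<^bold>\<in> u \<longleftrightarrow> w \<^bold>\<in> x \<and> sat ((interleave ?e c)(0 := w)) \<phi>"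
    using separation by metis
  have "(interleave ?e c)(0 := w) = interleave (?e(0 := w)) c" for w
    by (auto simp: fun_eq_iff interleave_def)
  then have "sat ((interleave ?e c)(0 := w)) \<phi> \<longleftrightarrow> P w" for w
    using \<phi>[of "?e(0 := w)"] by simp
  with u show thesis by (intro that[of u]) simp
qed

definition upair :: "'a \<Rightarrow> 'a \<Rightarrow> 'a" where
  "upair a b = (THE u. is_upair u a b)"

lemma is_upair_iff: "is_upair u a b \<longleftrightarrow> u = upair a b"
proof -
  have "\<exists>!u. is_upair u a b"
    using pairing[of a b] extensionality unfolding is_upair_def by metis
  then show ?thesis unfolding upair_def by (metis theI_unique)
qed

lemma mem_upair [simp]: "w \<^bold>\<in> upair a b \<longleftrightarrow> w = a \<or> w = b"
  using is_upair_iff[of "upair a b" a b] unfolding is_upair_def by simp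

definition pr :: "'a \<Rightarrow> 'a \<Rightarrow> 'a" where
  "pr a b = upair (upair a a) (upair a b)"

lemma is_pair_iff: "is_pair p a b \<longleftrightarrow> p = pr a b"
  unfolding is_pair_def is_upair_iff pr_def by blast

lemma dft_upair: "dft t \<Longrightarrow> dft u \<Longrightarrow> dft (\<lambda>e. upair (t e) (u e))"
  unfolding dft_def[of "\<lambda>e. upair (t e) (u e)"] is_upair_iff[symmetric]
  by (intro dfn_basic dft_shift)

lemma upair_eq_iff: "upair a b = upair c d \<longleftrightarrow> a = c \<and> b = d \<or> a = d \<and> b = c"
proof
  assume "upair a b = upair c d"
  then have "w = a \<or> w = b \<longleftrightarrow> w = c \<or> w = d" for w
    by (metis mem_upair)
  then show "a = c \<and> b = d \<or> a = d \<and> b = c" by metis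
next
  assume "a = c \<and> b = d \<or> a = d \<and> b = c"
  then show "upair a b = upair c d" by (intro extensionality) auto
qed

lemma pr_inj [simp]: "pr a b = pr c d \<longleftrightarrow> a = c \<and> b = d"
  unfolding pr_def upair_eq_iff by auto

lemma maps_iff: "maps f x y \<longleftrightarrow> pr x y \<^bold>\<in> f"
  unfolding maps_def is_pair_iff by blast

lemma dft_pr: "dft t \<Longrightarrow> dft u \<Longrightarrow> dft (\<lambda>e. pr (t e) (u e))"
  unfolding dft_def[of "\<lambda>e. pr (t e) (u e)"] is_pair_iff[symmetric]
  by (intro dfn_basic dft_shift)

text \<open>The explicit default keeps the graph definable: where there is no unique value, the
  result is the fixed parameter \<open>undefined\<close> rather than an unspecified value of
  \<open>THE\<close> that might vary with \<open>f\<close> and \<open>x\<close>.\<close>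

definition app :: "'a \<Rightarrow> 'a \<Rightarrow> 'a" where
  "app f x = (if \<exists>!y. maps f x y then THE y. maps f x y else undefined)"

lemma app_iff: "y = app f x \<longleftrightarrow>
    (\<exists>!z. maps f x z) \<and> maps f x y \<or> \<not> (\<exists>!z. maps f x z) \<and> y = undefined"
  unfolding app_def by (auto intro: theI2 the1_equality[symmetric])

lemma dft_app: "dft t \<Longrightarrow> dft u \<Longrightarrow> dft (\<lambda>e. app (t e) (u e))"
  unfolding dft_def[of "\<lambda>e. app (t e) (u e)"] app_iff
  by (intro dfn_basic dft_shift)

lemma is_fun_iff: "is_fun f A B \<longleftrightarrow>
    (\<forall>p. p \<^bold>\<in> f \<longrightarrow> (\<exists>x y. x \<^bold>\<in> A \<and> y \<^bold>\<in> B \<and> p = pr x y)) \<and> (\<forall>x. x \<^bold>\<in> A \<longrightarrow> (\<exists>!y. maps f x y))"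
  unfolding is_fun_def is_pair_iff ..

lemma maps_app:
  assumes "is_fun f A B"
  shows "maps f x y \<longleftrightarrow> x \<^bold>\<in> A \<and> y = app f x"
proof -
  have "x \<^bold>\<in> A" if "maps f x y" for y
    using assms that unfolding is_fun_iff maps_iff by fastforce
  moreover have "\<exists>!y. maps f x y" if "x \<^bold>\<in> A"
    using assms that unfolding is_fun_iff by blast
  ultimately show ?thesis unfolding app_iff by blast
qed

lemma app_mem:
  assumes "is_fun f A B" "x \<^bold>\<in> A"
  shows "app f x \<^bold>\<in> B"
proof -
  have "pr x (app f x) \<^bold>\<in> f"
    using maps_app[OF assms(1), of x "app f x"] assms(2) unfolding maps_iff by blast
  then show ?thesis using assms(1) unfolding is_fun_iff by fastforce
qed

lemma fun_mem_iff:
  assumes "is_fun f A B"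
  shows "p \<^bold>\<in> f \<longleftrightarrow> (\<exists>x. x \<^bold>\<in> A \<and> p = pr x (app f x))"
proof -
  have "p \<^bold>\<in> f \<longleftrightarrow> (\<exists>x y. p = pr x y \<and> maps f x y)"
    using assms unfolding is_fun_iff maps_iff by blast
  then show ?thesis unfolding maps_app[OF assms] by blast
qed

lemma fun_eqI:
  "is_fun f A B \<Longrightarrow> is_fun f' A B' \<Longrightarrow> (\<And>x. x \<^bold>\<in> A \<Longrightarrow> app f x = app f' x) \<Longrightarrow> f = f'"
  by (rule extensionality) (auto simp: fun_mem_iff)

lemma is_funI:
  assumes "\<And>p. p \<^bold>\<in> f \<longleftrightarrow> (\<exists>x. x \<^bold>\<in> A \<and> p = pr x (h x))" "\<And>x. x \<^bold>\<in> A \<Longrightarrow> h x \<^bold>\<in> B"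
  shows "is_fun f A B" "\<And>x. x \<^bold>\<in> A \<Longrightarrow> app f x = h x"
proof -
  show f: "is_fun f A B"
    unfolding is_fun_iff maps_iff assms(1) using assms(2) by auto
  show "app f x = h x" if "x \<^bold>\<in> A" for x
    using maps_app[OF f, of x "h x"] that unfolding maps_iff assms(1) by auto
qed

lemma is_fun_mono:
  assumes "is_fun f A B" "\<And>x. x \<^bold>\<in> A \<Longrightarrow> app f x \<^bold>\<in> B'"
  shows "is_fun f A B'"
  by (rule is_funI[where h = "app f"]) (use assms in \<open>auto simp: fun_mem_iff\<close>)

lemma is_comp_iff:
  assumes "is_fun f A B" "is_fun g B C"
  shows "is_comp h g f \<longleftrightarrow> is_fun h A C \<and> (\<forall>x. x \<^bold>\<in> A \<longrightarrow> app h x = app g (app f x))"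
proof -
  have "is_comp h g f \<longleftrightarrow> (\<forall>p. p \<^bold>\<in> h \<longleftrightarrow> (\<exists>x. x \<^bold>\<in> A \<and> p = pr x (app g (app f x))))"
    using app_mem[OF assms(1)]
    unfolding is_comp_def is_pair_iff maps_app[OF assms(1)] maps_app[OF assms(2)] by metis
  also have "\<dots> \<longleftrightarrow> is_fun h A C \<and> (\<forall>x. x \<^bold>\<in> A \<longrightarrow> app h x = app g (app f x))" (is "?L \<longleftrightarrow> ?R")
  proof
    assume L: ?L
    show ?R
      using is_funI[of h A "\<lambda>x. app g (app f x)" C] L app_mem[OF assms(1)] app_mem[OF assms(2)]
      by blast
  next
    assume ?R
    then show ?L using fun_mem_iff[of h A C] by metis
  qed
  finally show ?thesis .
qed

text \<open>\<open>SOME\<close> selects a set that extensionality determines, so no choice enters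
  the model. \<open>Power\<close> serves to bound comprehensions and never has to be expressed by a
  formula.\<close>

definition Power :: "'a \<Rightarrow> 'a" where
  "Power x = (SOME u. \<forall>w. w \<^bold>\<in> u \<longleftrightarrow> subset w x)"

lemma mem_Power [simp]: "w \<^bold>\<in> Power x \<longleftrightarrow> (\<forall>z. z \<^bold>\<in> w \<longrightarrow> z \<^bold>\<in> x)"
  using someI_ex[OF powerset[of x]] unfolding Power_def subset_def by blast

definition Unions :: "'a \<Rightarrow> 'a" where
  "Unions x = (SOME u. \<forall>w. w \<^bold>\<in> u \<longleftrightarrow> (\<exists>y. y \<^bold>\<in> x \<and> w \<^bold>\<in> y))"

lemma mem_Unions [simp]: "w \<^bold>\<in> Unions x \<longleftrightarrow> (\<exists>y. y \<^bold>\<in> x \<and> w \<^bold>\<in> y)"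
  using someI_ex[OF union[of x]] unfolding Unions_def by blast

definition Union2 :: "'a \<Rightarrow> 'a \<Rightarrow> 'a" where
  "Union2 x y = Unions (upair x y)"

lemma mem_Union2 [simp]: "w \<^bold>\<in> Union2 x y \<longleftrightarrow> w \<^bold>\<in> x \<or> w \<^bold>\<in> y"
  unfolding Union2_def by auto

definition Times :: "'a \<Rightarrow> 'a \<Rightarrow> 'a" where
  "Times A B = (SOME u. \<forall>w. w \<^bold>\<in> u \<longleftrightarrow> (\<exists>a b. a \<^bold>\<in> A \<and> b \<^bold>\<in> B \<and> w = pr a b))"

lemma mem_Times: "w \<^bold>\<in> Times A B \<longleftrightarrow> (\<exists>a b. a \<^bold>\<in> A \<and> b \<^bold>\<in> B \<and> w = pr a b)"
proof -
  have "dfn (\<lambda>e. \<exists>a b. a \<^bold>\<in> A \<and> b \<^bold>\<in> B \<and> e 0 = pr a b)"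
    by (intro dfn_basic dft_pr)
  then obtain u where u: "\<And>w. w \<^bold>\<in> u \<longleftrightarrow>
      w \<^bold>\<in> Power (Power (Union2 A B)) \<and> (\<exists>a b. a \<^bold>\<in> A \<and> b \<^bold>\<in> B \<and> w = pr a b)"
    by (rule sep_ex) blast
  have "pr a b \<^bold>\<in> Power (Power (Union2 A B))" if "a \<^bold>\<in> A" "b \<^bold>\<in> B" for a b
    using that by (auto simp: pr_def)
  with u have "\<exists>u. \<forall>w. w \<^bold>\<in> u \<longleftrightarrow> (\<exists>a b. a \<^bold>\<in> A \<and> b \<^bold>\<in> B \<and> w = pr a b)" by blast
  from someI_ex[OF this] show ?thesis unfolding Times_def by blast
qed

lemma pr_mem_Times [simp]: "pr a b \<^bold>\<in> Times A B \<longleftrightarrow> a \<^bold>\<in> A \<and> b \<^bold>\<in> B"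
  unfolding mem_Times by simp

definition Funs :: "'a \<Rightarrow> 'a \<Rightarrow> 'a" where
  "Funs A B = (SOME K. is_funset K A B)"

lemma is_funset_Funs: "is_funset (Funs A B) A B"
proof -
  have "dfn (\<lambda>e. is_fun (e 0) A B)" by (intro dfn_basic)
  then obtain K where K: "\<And>w. w \<^bold>\<in> K \<longleftrightarrow> w \<^bold>\<in> Power (Times A B) \<and> is_fun w A B"
    by (rule sep_ex) blast
  have "f \<^bold>\<in> Power (Times A B)" if "is_fun f A B" for f
    using that unfolding mem_Power mem_Times is_fun_iff by blast
  with K have "is_funset K A B" unfolding is_funset_def by blast
  then show ?thesis unfolding Funs_def by (rule someI)
qed

lemma mem_Funs [simp]: "f \<^bold>\<in> Funs A B \<longleftrightarrow> is_fun f A B"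
  using is_funset_Funs unfolding is_funset_def by blast

lemma is_funset_iff: "is_funset K A B \<longleftrightarrow> K = Funs A B"
proof
  assume "is_funset K A B"
  then show "K = Funs A B"
    by (intro extensionality) (simp add: is_funset_def)
qed (simp add: is_funset_Funs)

text \<open>No choice is involved: the values are unique, so separation from
  \<open>Times A B\<close> yields the graph. This takes the place of choice wherever a family of
  objects must be collected.\<close>

lemma fun_choice:
  assumes "dfn (\<lambda>e. R (e 0) (e (Suc 0)))" "\<And>x. x \<^bold>\<in> A \<Longrightarrow> \<exists>!y. y \<^bold>\<in> B \<and> R x y"
  obtains f where "is_fun f A B" "\<And>x. x \<^bold>\<in> A \<Longrightarrow> R x (app f x)"
proof -
  \<comment> \<open>Under the binders for \<open>x\<close> and then \<open>y\<close>, the inner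
    \<open>y\<close> has index 0, so the two slots are transposed.\<close>
  have R: "dfn (\<lambda>e. R (e (Suc 0)) (e 0))"
  proof -
    have "inj (\<lambda>n::nat. if n = 0 then 1 else if n = 1 then 0 else n)"
      by (auto simp: inj_def)
    from dfn_rename[OF assms(1) this] show ?thesis by simp
  qed
  have "dfn (\<lambda>e. \<exists>x y. e 0 = pr x y \<and> R x y)"
    by (intro dfn_basic dft_pr R)
  then obtain f where f:
    "\<And>w. w \<^bold>\<in> f \<longleftrightarrow> w \<^bold>\<in> Times A B \<and> (\<exists>x y. w = pr x y \<and> R x y)"
    by (rule sep_ex) blast
  define h where "h x = (THE y. y \<^bold>\<in> B \<and> R x y)" for x
  have h: "h x \<^bold>\<in> B" "R x (h x)" if "x \<^bold>\<in> A" for x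
    using theI'[OF assms(2)[OF that]] unfolding h_def by auto
  have "p \<^bold>\<in> f \<longleftrightarrow> (\<exists>x. x \<^bold>\<in> A \<and> p = pr x (h x))" for p
    unfolding f mem_Times using h assms(2) by (metis pr_inj)
  from is_funI[OF this h(1)] h(2) that show thesis by metis
qed

lemma lam_ex:
  assumes "dft (\<lambda>e. h (e 0))" "\<And>x. x \<^bold>\<in> A \<Longrightarrow> h x \<^bold>\<in> B"
  obtains f where "is_fun f A B" "\<And>x. x \<^bold>\<in> A \<Longrightarrow> app f x = h x"
proof -
  have "dfn (\<lambda>e. e (Suc 0) = h (e 0))"
    by (rule dfn_eq[OF dft_var assms(1)])
  from fun_choice[OF this, of A B] show thesis using assms(2) that by blast
qed

lemma comp_ex:
  assumes "is_fun f A B" "is_fun g B C"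
  obtains h where "is_fun h A C" "\<And>x. x \<^bold>\<in> A \<Longrightarrow> app h x = app g (app f x)"
proof (rule lam_ex)
  show "dft (\<lambda>e. app g (app f (e 0)))" by (intro dft_app dft_var dft_const)
  show "app g (app f x) \<^bold>\<in> C" if "x \<^bold>\<in> A" for x
    using that assms app_mem by blast
qed (use that in blast)

section \<open>Codes for infinitary terms\<close>

definition suc :: "'a \<Rightarrow> 'a" where
  "suc n = Union2 n (upair n n)"

lemma mem_suc [simp]: "w \<^bold>\<in> suc n \<longleftrightarrow> w \<^bold>\<in> n \<or> w = n"
  unfolding suc_def by simp

lemma eq_suc_iff: "y = suc n \<longleftrightarrow> (\<forall>w. w \<^bold>\<in> y \<longleftrightarrow> w \<^bold>\<in> n \<or> w = n)"
  using extensionality[of y "suc n"] by auto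

lemma dft_suc: "dft t \<Longrightarrow> dft (\<lambda>e. suc (t e))"
  unfolding dft_def[of "\<lambda>e. suc (t e)"] eq_suc_iff by (intro dfn_basic dft_shift)

text \<open>Two distinct sets with the same successor would be members of each other, which
  foundation for \<open>upair m n\<close> forbids.\<close>

lemma suc_inj [simp]: "suc m = suc n \<longleftrightarrow> m = n"
proof
  assume eq: "suc m = suc n"
  show "m = n"
  proof (rule ccontr)
    assume "m \<noteq> n"
    have "m \<^bold>\<in> suc n" "n \<^bold>\<in> suc m" unfolding eq[symmetric] by simp (simp add: eq)
    with \<open>m \<noteq> n\<close> have mn: "m \<^bold>\<in> n" "n \<^bold>\<in> m" by auto
    have "\<exists>y. y \<^bold>\<in> upair m n \<and> (\<forall>z. z \<^bold>\<in> y \<longrightarrow> \<not> z \<^bold>\<in> upair m n)"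
      by (rule foundation) (use mem_upair in blast)
    with mn show False by auto
  qed
qed simp

text \<open>Any inductive set serves as a supply of positions; the coding relies only on closure
  under \<open>suc\<close>, its injectivity, and a starting point that is no successor.\<close>

lemma naturals_ex:
  obtains N z where "z \<^bold>\<in> N" "\<And>n. n \<^bold>\<in> N \<Longrightarrow> suc n \<^bold>\<in> N" "\<And>n. suc n \<noteq> z" "\<And>n. z \<noteq> suc n"
proof -
  obtain N z where "is_empty z" "z \<^bold>\<in> N"
    and *: "\<And>n. n \<^bold>\<in> N \<Longrightarrow> \<exists>s. s \<^bold>\<in> N \<and> (\<forall>w. w \<^bold>\<in> s \<longleftrightarrow> w \<^bold>\<in> n \<or> w = n)"
    using infinity by blast
  have "suc n \<noteq> z" for n
    using \<open>is_empty z\<close> unfolding is_empty_def by (metis mem_suc)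
  moreover have "suc n \<^bold>\<in> N" if "n \<^bold>\<in> N" for n
    using *[OF that] unfolding eq_suc_iff[symmetric] by blast
  ultimately show thesis using that \<open>z \<^bold>\<in> N\<close> by metis
qed

text \<open>
  A set of codes closed under the formation of terms whose arguments are indexed by subsets of \<open>Y\<close>.
  Finite sequences in \<open>W\<close> are modelled by subsets of \<open>N \<times> W\<close>, on which prefixing an entry is
  injective. A code is a set of such sequences: the paths through the term, each ending in a label.
  This avoids the recursion on ordinals that would be needed to collect the terms themselves.
\<close>

lemma codes_ex:
  obtains B vc oc where
    "\<exists>b. b \<^bold>\<in> B" "is_fun vc G B" "is_fun oc (Times L (Power (Times Y B))) B"
    "\<And>v v'. \<lbrakk>v \<^bold>\<in> G; v' \<^bold>\<in> G; app vc v = app vc v'\<rbrakk> \<Longrightarrow> v = v'"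
    "\<And>v l f. \<lbrakk>v \<^bold>\<in> G; l \<^bold>\<in> L; f \<^bold>\<in> Power (Times Y B)\<rbrakk> \<Longrightarrow> app vc v \<noteq> app oc (pr l f)"
    "\<And>l l' f f'. \<lbrakk>l \<^bold>\<in> L; l' \<^bold>\<in> L; f \<^bold>\<in> Power (Times Y B); f' \<^bold>\<in> Power (Times Y B);
        app oc (pr l f) = app oc (pr l' f')\<rbrakk> \<Longrightarrow> l = l'"
    "\<And>l f f' D. \<lbrakk>l \<^bold>\<in> L; \<forall>y. y \<^bold>\<in> D \<longrightarrow> y \<^bold>\<in> Y; is_fun f D B; is_fun f' D B;
        app oc (pr l f) = app oc (pr l f')\<rbrakk> \<Longrightarrow> f = f'"
proof -
  obtain N z where N: "z \<^bold>\<in> N" "\<And>n. n \<^bold>\<in> N \<Longrightarrow> suc n \<^bold>\<in> N"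
    and z [simp]: "\<And>n. suc n \<noteq> z" "\<And>n. z \<noteq> suc n"
    by (rule naturals_ex) blast
  define W where "W = Union2 Y (Union2 L G)"
  define C where "C = Power (Times N W)"
  \<comment> \<open>A full power set is closed under code formation without any recursion. It also
    contains sets that code no term, which the evaluation relation filters out.\<close>
  define B where "B = Power C"
  \<comment> \<open>A terminal label is a single entry at a nonzero position. Prefixed sequences
    always have an entry at \<open>z\<close>, so the two kinds cannot be confused; position
    \<open>suc z\<close> marks operation labels and \<open>suc (suc z)\<close> marks
    generators.\<close>
  define lab where "lab k l = upair (pr k l) (pr k l)" for k l
  have mem_lab [simp]: "p \<^bold>\<in> lab k l \<longleftrightarrow> p = pr k l" for p k l by (simp add: lab_def)
  have lab_inj: "lab k l = lab k' l' \<longleftrightarrow> k = k' \<and> l = l'" for k l k' l'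
    by (metis mem_lab pr_inj)
  have lab_C: "lab k l \<^bold>\<in> C" if "k \<^bold>\<in> N" "l \<^bold>\<in> W" for k l
    using that by (auto simp: C_def)
  \<comment> \<open>\<open>c\<close> is \<open>s\<close> with all positions raised by one and
    \<open>y\<close> put at \<open>z\<close>, stated as a relation so that it is visibly a
    formula.\<close>
  define iscons where
    "iscons c y s \<longleftrightarrow> (\<forall>p. p \<^bold>\<in> c \<longleftrightarrow> p = pr z y \<or> (\<exists>n w. p = pr (suc n) w \<and> pr n w \<^bold>\<in> s))" for c y s
  have dfn_iscons: "dfn (\<lambda>e. iscons (t e) (u e) (v e))" if "dft t" "dft u" "dft v" for t u v
    unfolding iscons_def by (intro dfn_basic dft_pr dft_suc dft_shift that)
  have cons_ex: "\<exists>c. c \<^bold>\<in> C \<and> iscons c y s" if "y \<^bold>\<in> W" "s \<^bold>\<in> C" for y s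
  proof -
    have "dfn (\<lambda>e. e 0 = pr z y \<or> (\<exists>n w. e 0 = pr (suc n) w \<and> pr n w \<^bold>\<in> s))"
      by (intro dfn_basic dft_pr dft_suc)
    then obtain c where c: "\<And>p. p \<^bold>\<in> c \<longleftrightarrow> p \<^bold>\<in> Times N W \<and>
        (p = pr z y \<or> (\<exists>n w. p = pr (suc n) w \<and> pr n w \<^bold>\<in> s))"
      by (rule sep_ex) blast
    have "n \<^bold>\<in> N \<and> w \<^bold>\<in> W" if "pr n w \<^bold>\<in> s" for n w
      using \<open>s \<^bold>\<in> C\<close> that pr_mem_Times unfolding C_def mem_Power by blast
    then have "iscons c y s" unfolding iscons_def c using N \<open>y \<^bold>\<in> W\<close> by auto
    moreover have "c \<^bold>\<in> C" unfolding C_def using c by simp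
    ultimately show ?thesis by blast
  qed
  \<comment> \<open>Membership in \<open>C\<close> matters here: elements of \<open>s\<close> that
    are not pairs would be lost in the shift.\<close>
  have cons_inj: "y = y' \<and> s = s'"
    if "iscons c y s" "iscons c y' s'" "s \<^bold>\<in> C" "s' \<^bold>\<in> C" for c y s y' s'
  proof
    have "pr z y \<^bold>\<in> c" using that(1) unfolding iscons_def by blast
    then show "y = y'" using that(2) unfolding iscons_def by auto
    have *: "pr n w \<^bold>\<in> s \<longleftrightarrow> pr (suc n) w \<^bold>\<in> c" if "iscons c y s" for y s n w
      using that unfolding iscons_def by auto
    have "pr n w \<^bold>\<in> s \<longleftrightarrow> pr n w \<^bold>\<in> s'" for n w
      using *[OF that(1)] *[OF that(2)] by simp
    moreover have "\<exists>n w. p = pr n w" if "p \<^bold>\<in> s \<or> p \<^bold>\<in> s'" for p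
      using that \<open>s \<^bold>\<in> C\<close> \<open>s' \<^bold>\<in> C\<close> unfolding C_def mem_Power mem_Times by blast
    ultimately show "s = s'" by (intro extensionality) metis
  qed
  have lab_cons: "\<not> iscons (lab (suc k) l) y s" for k l y s
    unfolding iscons_def by (auto intro!: exI[of _ "pr z y"])

  have "\<exists>vc. is_fun vc G B \<and> (\<forall>v. v \<^bold>\<in> G \<longrightarrow> app vc v = upair (lab (suc (suc z)) v) (lab (suc (suc z)) v))"
  proof -
    have "upair (lab (suc (suc z)) v) (lab (suc (suc z)) v) \<^bold>\<in> B" if "v \<^bold>\<in> G" for v
      unfolding B_def using that N by (auto intro!: lab_C simp: W_def)
    moreover have "dft (\<lambda>e. upair (lab (suc (suc z)) (e 0)) (lab (suc (suc z)) (e 0)))"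
      unfolding lab_def by (intro dft_upair dft_pr dft_var dft_const)
    ultimately show ?thesis
      using lam_ex[of "\<lambda>v. upair (lab (suc (suc z)) v) (lab (suc (suc z)) v)" G B] by blast
  qed
  then obtain vc where vc: "is_fun vc G B"
    and vc_app: "\<And>v. v \<^bold>\<in> G \<Longrightarrow> app vc v = upair (lab (suc (suc z)) v) (lab (suc (suc z)) v)"
    by blast

  define iscode where "iscode q c \<longleftrightarrow> (\<exists>l f. q = pr l f \<and> (\<forall>x. x \<^bold>\<in> c \<longleftrightarrow>
    x = lab (suc z) l \<or> (\<exists>y b s. pr y b \<^bold>\<in> f \<and> s \<^bold>\<in> b \<and> iscons x y s)))" for q c
  have "dfn (\<lambda>e. iscode (e 0) (e (Suc 0)))"
    unfolding iscode_def lab_def by (intro dfn_basic dft_upair dft_pr dfn_iscons)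
  moreover have "\<exists>!c. c \<^bold>\<in> B \<and> iscode q c" if q': "q \<^bold>\<in> Times L (Power (Times Y B))" for q
  proof -
    obtain l f where q: "q = pr l f" and l: "l \<^bold>\<in> L" and f: "f \<^bold>\<in> Power (Times Y B)"
      using q' unfolding mem_Times by blast
    have "dfn (\<lambda>e. e 0 = lab (suc z) l \<or> (\<exists>y b s. pr y b \<^bold>\<in> f \<and> s \<^bold>\<in> b \<and> iscons (e 0) y s))"
      by (intro dfn_basic dft_pr dfn_iscons)
    then obtain c where c: "\<And>x. x \<^bold>\<in> c \<longleftrightarrow> x \<^bold>\<in> C \<and>
        (x = lab (suc z) l \<or> (\<exists>y b s. pr y b \<^bold>\<in> f \<and> s \<^bold>\<in> b \<and> iscons x y s))"
      by (rule sep_ex) blast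
    have "x \<^bold>\<in> C" if "pr y b \<^bold>\<in> f" "s \<^bold>\<in> b" "iscons x y s" for x y b s
    proof -
      have "y \<^bold>\<in> W" "s \<^bold>\<in> C"
        using that f unfolding mem_Power B_def W_def by (fastforce dest: spec)+
      from cons_ex[OF this] obtain x' where "x' \<^bold>\<in> C" "iscons x' y s" by blast
      moreover have "x = x'"
        using that(3) \<open>iscons x' y s\<close> unfolding iscons_def by (intro extensionality) metis
      ultimately show ?thesis by simp
    qed
    moreover have "lab (suc z) l \<^bold>\<in> C" using l N by (auto intro!: lab_C simp: W_def)
    ultimately have "iscode q c" unfolding iscode_def q using c by auto
    moreover have "c \<^bold>\<in> B" unfolding B_def using c by simp
    moreover have "c = c'" if "iscode q c'" for c'
      using that \<open>iscode q c\<close> unfolding iscode_def q by (intro extensionality) auto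
    ultimately show ?thesis by blast
  qed
  ultimately obtain oc where oc: "is_fun oc (Times L (Power (Times Y B))) B"
    and oc_code: "\<And>q. q \<^bold>\<in> Times L (Power (Times Y B)) \<Longrightarrow> iscode q (app oc q)"
    by (rule fun_choice) blast+
  have oc_app: "x \<^bold>\<in> app oc (pr l f) \<longleftrightarrow>
      x = lab (suc z) l \<or> (\<exists>y b s. pr y b \<^bold>\<in> f \<and> s \<^bold>\<in> b \<and> iscons x y s)"
    if l: "l \<^bold>\<in> L" and f: "f \<^bold>\<in> Power (Times Y B)" for x l f
  proof -
    have "pr l f \<^bold>\<in> Times L (Power (Times Y B))"
      unfolding pr_mem_Times using l f ..
    from oc_code[OF this] show ?thesis unfolding iscode_def pr_inj by blast
  qed

  show thesis
  proof (rule that[OF _ vc oc])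
    show "\<exists>b. b \<^bold>\<in> B"
      unfolding B_def by (rule exI[of _ C]) simp
  next
    fix v v' assume "v \<^bold>\<in> G" "v' \<^bold>\<in> G" "app vc v = app vc v'"
    then show "v = v'" by (simp add: vc_app upair_eq_iff lab_inj)
  next
    fix v l f assume "v \<^bold>\<in> G" "l \<^bold>\<in> L" "f \<^bold>\<in> Power (Times Y B)"
    then have "lab (suc z) l \<^bold>\<in> app oc (pr l f)" "\<not> lab (suc z) l \<^bold>\<in> app vc v"
      by (simp_all add: oc_app vc_app lab_inj del: mem_Power)
    then show "app vc v \<noteq> app oc (pr l f)" by metis
  next
    fix l l' f f'
    assume *: "l \<^bold>\<in> L" "l' \<^bold>\<in> L" "f \<^bold>\<in> Power (Times Y B)" "f' \<^bold>\<in> Power (Times Y B)"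
      "app oc (pr l f) = app oc (pr l' f')"
    have "lab (suc z) l \<^bold>\<in> app oc (pr l' f')"
      unfolding *(5)[symmetric] oc_app[OF *(1,3)] by blast
    then show "l = l'"
      unfolding oc_app[OF *(2,4)] using lab_cons lab_inj by blast
  next
    fix l f f' D
    assume l: "l \<^bold>\<in> L" and D: "\<forall>y. y \<^bold>\<in> D \<longrightarrow> y \<^bold>\<in> Y" and f: "is_fun f D B" "is_fun f' D B"
      and eq: "app oc (pr l f) = app oc (pr l f')"
    have Pow: "f \<^bold>\<in> Power (Times Y B)" if "is_fun f D B" for f
      using that D unfolding mem_Power mem_Times is_fun_iff by blast
    \<comment> \<open>The argument at \<open>y\<close> is read off as the set of tails of the paths
      starting with \<open>y\<close>. The domain \<open>D\<close> has to be known beforehand, since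
      an empty argument at \<open>y\<close> leaves no path behind.\<close>
    have *: "s \<^bold>\<in> app f y \<longleftrightarrow> (\<exists>x. x \<^bold>\<in> app oc (pr l f) \<and> iscons x y s)"
      if f: "is_fun f D B" and y: "y \<^bold>\<in> D" and s: "s \<^bold>\<in> C" for f y s
    proof
      assume "s \<^bold>\<in> app f y"
      moreover have "pr y (app f y) \<^bold>\<in> f" unfolding fun_mem_iff[OF f] using y by blast
      moreover have "y \<^bold>\<in> W" using y D unfolding W_def by simp
      moreover obtain x where "iscons x y s" using cons_ex[OF \<open>y \<^bold>\<in> W\<close> s] by blast
      ultimately show "\<exists>x. x \<^bold>\<in> app oc (pr l f) \<and> iscons x y s"
        unfolding oc_app[OF l Pow[OF f]] by blast
    next
      assume "\<exists>x. x \<^bold>\<in> app oc (pr l f) \<and> iscons x y s"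
      then obtain x where xc: "x \<^bold>\<in> app oc (pr l f)" "iscons x y s" by blast
      then have "x \<noteq> lab (suc z) l" using lab_cons by metis
      then obtain y' b s' where x: "iscons x y s" "pr y' b \<^bold>\<in> f" "s' \<^bold>\<in> b" "iscons x y' s'"
        using xc(1) unfolding oc_app[OF l Pow[OF f]] using xc(2) by blast
      have b: "y' \<^bold>\<in> D" "b = app f y'"
        using x(2) unfolding maps_app[OF f, unfolded maps_iff] by simp_all
      have "s' \<^bold>\<in> C" using app_mem[OF f b(1)] x(3) b(2) unfolding B_def by simp
      with cons_inj[OF x(1,4) s] x(3) b(2) show "s \<^bold>\<in> app f y" by simp
    qed
    show "f = f'"
    proof (rule fun_eqI[OF f])
      fix y assume y: "y \<^bold>\<in> D"
      have "s \<^bold>\<in> C" if "s \<^bold>\<in> app f y \<or> s \<^bold>\<in> app f' y" for s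
        using that app_mem[OF f(1) y] app_mem[OF f(2) y] unfolding B_def by auto
      then have "s \<^bold>\<in> app f y \<longleftrightarrow> s \<^bold>\<in> app f' y" for s
        using *[OF f(1) y] *[OF f(2) y] unfolding eq by blast
      then show "app f y = app f' y" by (intro extensionality) simp
    qed
  qed
qed

section \<open>Covers, structures and homomorphisms\<close>

lemma fun_dom_unique: "is_fun f A B \<Longrightarrow> is_fun f A' B' \<Longrightarrow> A = A'"
  by (rule extensionality) (metis maps_app)

lemma is_surjD:
  assumes "is_surj p D X"
  shows "is_fun p D X" "x \<^bold>\<in> X \<Longrightarrow> \<exists>y. maps p y x"
  using assms unfolding is_surj_def by blast+

text \<open>
  Applying AMC once, to the disjoint union \<open>X\<close> of all arities, avoids choosing a set of covers for
  every arity. A cover of one summand is extended to \<open>X\<close> by junk over the others.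
\<close>

lemma covers_ex:
  assumes AMC "is_fun Ar Op C"
  obtains X P Y where
    "\<And>\<sigma> i. pr \<sigma> i \<^bold>\<in> X \<longleftrightarrow> \<sigma> \<^bold>\<in> Op \<and> i \<^bold>\<in> app Ar \<sigma>"
    "\<And>p D y. p \<^bold>\<in> P \<Longrightarrow> is_surj p D X \<Longrightarrow> y \<^bold>\<in> D \<Longrightarrow> y \<^bold>\<in> Y"
    "\<And>B M x \<sigma>. \<lbrakk>\<exists>b. b \<^bold>\<in> B; \<sigma> \<^bold>\<in> Op; is_fun x (app Ar \<sigma>) M;
        \<And>i. i \<^bold>\<in> app Ar \<sigma> \<Longrightarrow> \<exists>t. t \<^bold>\<in> B \<and> t \<^bold>\<in> app x i\<rbrakk> \<Longrightarrow>
      \<exists>p D f. p \<^bold>\<in> P \<and> is_surj p D X \<and> is_fun f D B \<and>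
        (\<forall>y i. maps p y (pr \<sigma> i) \<longrightarrow> app f y \<^bold>\<in> app x i)"
proof -
  have "dfn (\<lambda>e. \<exists>\<sigma> i. e 0 = pr \<sigma> i \<and> \<sigma> \<^bold>\<in> Op \<and> i \<^bold>\<in> app Ar \<sigma>)"
    by (intro dfn_basic dft_pr dft_app)
  then obtain X where X: "\<And>w. w \<^bold>\<in> X \<longleftrightarrow> w \<^bold>\<in> Times Op (Unions C) \<and>
      (\<exists>\<sigma> i. w = pr \<sigma> i \<and> \<sigma> \<^bold>\<in> Op \<and> i \<^bold>\<in> app Ar \<sigma>)"
    by (rule sep_ex) blast
  have X_iff: "pr \<sigma> i \<^bold>\<in> X \<longleftrightarrow> \<sigma> \<^bold>\<in> Op \<and> i \<^bold>\<in> app Ar \<sigma>" for \<sigma> i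
    unfolding X using app_mem[OF assms(2)] by auto
  obtain P where P: "\<And>Z q. is_surj q Z X \<Longrightarrow>
      \<exists>p Y f. p \<^bold>\<in> P \<and> is_surj p Y X \<and> is_fun f Y Z \<and> is_comp p q f"
    using assms(1) unfolding AMC_def by blast
  show thesis
  proof (rule that[OF X_iff])
    fix p D y assume p: "p \<^bold>\<in> P" "is_surj p D X" "y \<^bold>\<in> D"
    have "pr y (app p y) \<^bold>\<in> p"
      unfolding fun_mem_iff[OF is_surjD(1)[OF p(2)]] using p(3) by blast
    \<comment> \<open>A Kuratowski pair contains the singleton of its first component, so three
      unions over \<open>P\<close> reach every point of every domain.\<close>
    then have "upair y y \<^bold>\<in> Unions (Unions P)"
      using p(1) unfolding pr_def by auto
    then have "\<exists>w. w \<^bold>\<in> Unions (Unions P) \<and> y \<^bold>\<in> w"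
      using mem_upair by blast
    then show "y \<^bold>\<in> Unions (Unions (Unions P))"
      unfolding mem_Unions[of y "Unions (Unions P)"] .
  next
    fix B M x \<sigma>
    assume B: "\<exists>b. b \<^bold>\<in> B" and \<sigma>: "\<sigma> \<^bold>\<in> Op" and x: "is_fun x (app Ar \<sigma>) M"
      and ne: "\<And>i. i \<^bold>\<in> app Ar \<sigma> \<Longrightarrow> \<exists>t. t \<^bold>\<in> B \<and> t \<^bold>\<in> app x i"
    \<comment> \<open>\<open>Z\<close> pairs each point of \<open>X\<close> with an admissible
      member of \<open>B\<close>: over \<open>pr \<sigma> i\<close> a member of
      \<open>app x i\<close>, elsewhere any member of \<open>B\<close>, which is where nonemptiness
      of \<open>B\<close> enters. AMC is applied to its first projection \<open>q\<close>.\<close>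
    have "dfn (\<lambda>e. \<exists>\<xi> t. e 0 = pr \<xi> t \<and> (\<forall>i. \<xi> = pr \<sigma> i \<longrightarrow> t \<^bold>\<in> app x i))"
      by (intro dfn_basic dft_pr dft_app)
    then obtain Z where Z: "\<And>w. w \<^bold>\<in> Z \<longleftrightarrow> w \<^bold>\<in> Times X B \<and>
        (\<exists>\<xi> t. w = pr \<xi> t \<and> (\<forall>i. \<xi> = pr \<sigma> i \<longrightarrow> t \<^bold>\<in> app x i))"
      by (rule sep_ex) blast
    have Z_iff: "pr \<xi> t \<^bold>\<in> Z \<longleftrightarrow> \<xi> \<^bold>\<in> X \<and> t \<^bold>\<in> B \<and> (\<forall>i. \<xi> = pr \<sigma> i \<longrightarrow> t \<^bold>\<in> app x i)" for \<xi> t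
      unfolding Z by simp
    have Z_pr: "\<exists>\<xi> t. w = pr \<xi> t" if "w \<^bold>\<in> Z" for w
      using that unfolding Z by blast
    have "dfn (\<lambda>e. \<exists>t. e 0 = pr (e (Suc 0)) t)"
      by (intro dfn_basic dft_pr)
    moreover have "\<exists>!\<xi>. \<xi> \<^bold>\<in> X \<and> (\<exists>t. w = pr \<xi> t)" if "w \<^bold>\<in> Z" for w
      using Z_pr[OF that] that Z_iff by auto
    ultimately obtain q where q: "is_fun q Z X" "\<And>w. w \<^bold>\<in> Z \<Longrightarrow> \<exists>t. w = pr (app q w) t"
      by (rule fun_choice) blast+
    have "is_surj q Z X"
      unfolding is_surj_def
    proof (intro conjI allI impI q(1))
      fix \<xi> assume \<xi>: "\<xi> \<^bold>\<in> X"
      have "\<exists>t. pr \<xi> t \<^bold>\<in> Z"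
      proof (cases "\<exists>i. \<xi> = pr \<sigma> i")
        case True
        then obtain i where i: "\<xi> = pr \<sigma> i" by blast
        with \<xi> ne[of i] show ?thesis by (auto simp: Z_iff X_iff)
      next
        case False
        with B \<xi> show ?thesis by (auto simp: Z_iff)
      qed
      then obtain t where t: "pr \<xi> t \<^bold>\<in> Z" ..
      moreover have "app q (pr \<xi> t) = \<xi>" using q(2)[OF t] by (metis pr_inj)
      ultimately show "\<exists>w. w \<^bold>\<in> Z \<and> maps q w \<xi>" using maps_app[OF q(1)] by metis
    qed
    from P[OF this] obtain p D f where p: "p \<^bold>\<in> P" "is_surj p D X"
      and f: "is_fun f D Z" and comp: "is_comp p q f" by blast
    have pq: "app p y = app q (app f y)" if "y \<^bold>\<in> D" for y
      using comp that unfolding is_comp_iff[OF f q(1)] by blast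
    have "dfn (\<lambda>e. \<exists>\<xi>. app f (e 0) = pr \<xi> (e (Suc 0)))"
      by (intro dfn_basic dft_pr dft_app)
    moreover have "\<exists>!t. t \<^bold>\<in> B \<and> (\<exists>\<xi>. app f y = pr \<xi> t)" if "y \<^bold>\<in> D" for y
      using Z_pr[OF app_mem[OF f that]] app_mem[OF f that] Z_iff by auto
    ultimately obtain f' where f': "is_fun f' D B"
      "\<And>y. y \<^bold>\<in> D \<Longrightarrow> \<exists>\<xi>. app f y = pr \<xi> (app f' y)"
      by (rule fun_choice) blast+
    have "app f' y \<^bold>\<in> app x i" if "maps p y (pr \<sigma> i)" for y i
    proof -
      have y: "y \<^bold>\<in> D" "app p y = pr \<sigma> i"
        using that maps_app[OF is_surjD(1)[OF p(2)]] by auto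
      have "app f y = pr (pr \<sigma> i) (app f' y)"
        using f'(2)[OF y(1)] q(2)[OF app_mem[OF f y(1)]] pq[OF y(1)] y(2) by (metis pr_inj)
      with app_mem[OF f y(1)] show ?thesis by (simp add: Z_iff)
    qed
    then show "\<exists>p D f. p \<^bold>\<in> P \<and> is_surj p D X \<and> is_fun f D B \<and>
        (\<forall>y i. maps p y (pr \<sigma> i) \<longrightarrow> app f y \<^bold>\<in> app x i)"
      using p f'(1) by (intro exI[of _ p] exI[of _ D] exI[of _ f']) simp
  qed
qed

section \<open>Structures, homomorphisms and evaluations in terms of application\<close>

lemma maps_signature: "is_signature Op Ar \<Longrightarrow> maps Ar \<sigma> a \<longleftrightarrow> \<sigma> \<^bold>\<in> Op \<and> a = app Ar \<sigma>"
  unfolding is_signature_def using maps_app by blast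

lemma is_structure_iff:
  assumes "is_signature Op Ar"
  shows "is_structure Op Ar M F \<longleftrightarrow> (\<exists>C. is_fun F Op C) \<and>
    (\<forall>\<sigma>. \<sigma> \<^bold>\<in> Op \<longrightarrow> is_fun (app F \<sigma>) (Funs (app Ar \<sigma>) M) M)"
  unfolding is_structure_def maps_signature[OF assms] is_funset_iff
  by (auto simp: maps_app)

lemma structure_maps: "is_structure Op Ar M F \<Longrightarrow> maps F \<sigma> k \<longleftrightarrow> \<sigma> \<^bold>\<in> Op \<and> k = app F \<sigma>"
  unfolding is_structure_def using maps_app by blast

lemma structure_op_maps:
  assumes "is_signature Op Ar" "is_structure Op Ar M F" "\<sigma> \<^bold>\<in> Op" "is_fun x (app Ar \<sigma>) M"
  shows "maps (app F \<sigma>) x m \<longleftrightarrow> m = app (app F \<sigma>) x" "app (app F \<sigma>) x \<^bold>\<in> M"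
proof -
  have "is_fun (app F \<sigma>) (Funs (app Ar \<sigma>) M) M"
    using assms(2,3) unfolding is_structure_iff[OF assms(1)] by blast
  then show "maps (app F \<sigma>) x m \<longleftrightarrow> m = app (app F \<sigma>) x" "app (app F \<sigma>) x \<^bold>\<in> M"
    using assms(4) maps_app app_mem by auto
qed

text \<open>The composite of \<open>x\<close> with \<open>h\<close> exists and is unique, so the
  existential quantifier over it in the definition can be traded for a universal one, which is
  easier to instantiate.\<close>

lemma is_hom_iff:
  assumes sig: "is_signature Op Ar" and M: "is_structure Op Ar M F" and N: "is_structure Op Ar N H"
  shows "is_hom Op Ar M F N H h \<longleftrightarrow> is_fun h M N \<and>
    (\<forall>\<sigma> x y. \<sigma> \<^bold>\<in> Op \<and> is_fun x (app Ar \<sigma>) M \<and> is_fun y (app Ar \<sigma>) N \<and>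
      (\<forall>i. i \<^bold>\<in> app Ar \<sigma> \<longrightarrow> app y i = app h (app x i)) \<longrightarrow>
      app h (app (app F \<sigma>) x) = app (app H \<sigma>) y)"
proof (cases "is_fun h M N")
  case h: True
  define L where "L \<sigma> x \<longleftrightarrow> (\<exists>k l y m n. maps F \<sigma> k \<and> maps H \<sigma> l \<and> is_comp y h x \<and>
    maps k x m \<and> maps l y n \<and> maps h m n)" for \<sigma> x
  define R where "R \<sigma> x \<longleftrightarrow> (\<forall>y. is_fun y (app Ar \<sigma>) N \<and>
    (\<forall>i. i \<^bold>\<in> app Ar \<sigma> \<longrightarrow> app y i = app h (app x i)) \<longrightarrow>
    app h (app (app F \<sigma>) x) = app (app H \<sigma>) y)" for \<sigma> x
  have LR: "L \<sigma> x \<longleftrightarrow> R \<sigma> x" if \<sigma>: "\<sigma> \<^bold>\<in> Op" and x: "is_fun x (app Ar \<sigma>) M" for \<sigma> x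
  proof -
    obtain y where y: "is_fun y (app Ar \<sigma>) N"
      "\<And>i. i \<^bold>\<in> app Ar \<sigma> \<Longrightarrow> app y i = app h (app x i)"
      using comp_ex[OF x h] by blast
    have uniq: "y' = y" if "is_fun y' (app Ar \<sigma>) N"
      "\<And>i. i \<^bold>\<in> app Ar \<sigma> \<Longrightarrow> app y' i = app h (app x i)" for y'
      by (rule fun_eqI[OF that(1) y(1)]) (simp add: y(2) that(2))
    have comp: "is_comp y' h x \<longleftrightarrow> y' = y" for y'
      unfolding is_comp_iff[OF x h] using y uniq by blast
    have "L \<sigma> x \<longleftrightarrow> app h (app (app F \<sigma>) x) = app (app H \<sigma>) y"
      using structure_op_maps[OF sig M \<sigma> x] structure_op_maps(1)[OF sig N \<sigma> y(1)] \<sigma>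
      by (auto simp: L_def comp structure_maps[OF M] structure_maps[OF N] maps_app[OF h])
    also have "\<dots> \<longleftrightarrow> R \<sigma> x" unfolding R_def using y uniq by blast
    finally show ?thesis .
  qed
  have "is_hom Op Ar M F N H h \<longleftrightarrow> (\<forall>\<sigma> x. \<sigma> \<^bold>\<in> Op \<and> is_fun x (app Ar \<sigma>) M \<longrightarrow> L \<sigma> x)"
    unfolding is_hom_def maps_signature[OF sig] L_def[symmetric] using h by blast
  also have "\<dots> \<longleftrightarrow> (\<forall>\<sigma> x. \<sigma> \<^bold>\<in> Op \<and> is_fun x (app Ar \<sigma>) M \<longrightarrow> R \<sigma> x)"
    using LR by blast
  finally show ?thesis unfolding R_def using h by blast
qed (simp add: is_hom_def)

text \<open>The same exchange of quantifiers over a unique composite; \<open>term_closed\<close>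
  ensures that variables and compound terms lie in the domain of \<open>ev\<close>.\<close>

lemma is_eval_iff:
  assumes sig: "is_signature Op Ar" and M: "is_structure Op Ar M F"
    and \<rho>: "is_fun \<rho> V M" and T: "term_closed Op Ar V T"
  shows "is_eval Op Ar M F V T \<rho> ev \<longleftrightarrow> is_fun ev T M \<and>
    (\<forall>v t. v \<^bold>\<in> V \<and> is_var t v \<longrightarrow> app ev t = app \<rho> v) \<and>
    (\<forall>\<sigma> f t x. \<sigma> \<^bold>\<in> Op \<and> is_fun f (app Ar \<sigma>) T \<and> is_optm t \<sigma> f \<and> is_fun x (app Ar \<sigma>) M \<and>
      (\<forall>i. i \<^bold>\<in> app Ar \<sigma> \<longrightarrow> app x i = app ev (app f i)) \<longrightarrow> app ev t = app (app F \<sigma>) x)"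
proof (cases "is_fun ev T M")
  case ev: True
  define L where "L \<sigma> f t \<longleftrightarrow>
    (\<exists>g h m. maps F \<sigma> g \<and> is_comp h ev f \<and> maps g h m \<and> maps ev t m)" for \<sigma> f t
  define R where "R \<sigma> f t \<longleftrightarrow> (\<forall>x. is_fun x (app Ar \<sigma>) M \<and>
    (\<forall>i. i \<^bold>\<in> app Ar \<sigma> \<longrightarrow> app x i = app ev (app f i)) \<longrightarrow>
    app ev t = app (app F \<sigma>) x)" for \<sigma> f t
  have var: "(\<exists>m. maps \<rho> v m \<and> maps ev t m) \<longleftrightarrow> app ev t = app \<rho> v"
    if "v \<^bold>\<in> V" "is_var t v" for v t
    using that T unfolding maps_app[OF ev] maps_app[OF \<rho>] term_closed_def by auto
  have LR: "L \<sigma> f t \<longleftrightarrow> R \<sigma> f t"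
    if \<sigma>: "\<sigma> \<^bold>\<in> Op" and f: "is_fun f (app Ar \<sigma>) T" and t: "is_optm t \<sigma> f" for \<sigma> f t
  proof -
    obtain y where y: "is_fun y (app Ar \<sigma>) M"
      "\<And>i. i \<^bold>\<in> app Ar \<sigma> \<Longrightarrow> app y i = app ev (app f i)"
      using comp_ex[OF f ev] by blast
    have uniq: "y' = y" if "is_fun y' (app Ar \<sigma>) M"
      "\<And>i. i \<^bold>\<in> app Ar \<sigma> \<Longrightarrow> app y' i = app ev (app f i)" for y'
      by (rule fun_eqI[OF that(1) y(1)]) (simp add: y(2) that(2))
    have comp: "is_comp y' ev f \<longleftrightarrow> y' = y" for y'
      unfolding is_comp_iff[OF f ev] using y uniq by blast
    have "t \<^bold>\<in> T"
      using T \<sigma> f t unfolding term_closed_def maps_signature[OF sig] by blast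
    then have "L \<sigma> f t \<longleftrightarrow> app ev t = app (app F \<sigma>) y"
      using structure_op_maps[OF sig M \<sigma> y(1)] \<sigma>
      by (auto simp: L_def comp structure_maps[OF M] maps_app[OF ev])
    also have "\<dots> \<longleftrightarrow> R \<sigma> f t" unfolding R_def using y uniq by blast
    finally show ?thesis .
  qed
  have "is_eval Op Ar M F V T \<rho> ev \<longleftrightarrow>
    (\<forall>v t. v \<^bold>\<in> V \<and> is_var t v \<longrightarrow> (\<exists>m. maps \<rho> v m \<and> maps ev t m)) \<and>
    (\<forall>\<sigma> f t. \<sigma> \<^bold>\<in> Op \<and> is_fun f (app Ar \<sigma>) T \<and> is_optm t \<sigma> f \<longrightarrow> L \<sigma> f t)"
    unfolding is_eval_def maps_signature[OF sig] L_def[symmetric] using ev by blast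
  also have "\<dots> \<longleftrightarrow> (\<forall>v t. v \<^bold>\<in> V \<and> is_var t v \<longrightarrow> app ev t = app \<rho> v) \<and>
    (\<forall>\<sigma> f t. \<sigma> \<^bold>\<in> Op \<and> is_fun f (app Ar \<sigma>) T \<and> is_optm t \<sigma> f \<longrightarrow> R \<sigma> f t)"
    using LR var by simp
  finally show ?thesis unfolding R_def using ev by blast
qed (simp add: is_eval_def)

lemma is_eqn_iff: "is_eqn e V s t \<longleftrightarrow> e = pr V (pr s t)"
  unfolding is_eqn_def is_pair_iff by blast

lemma term_set_unique: "is_term_set Op Ar V T \<Longrightarrow> is_term_set Op Ar V T' \<Longrightarrow> T = T'"
  unfolding is_term_set_def subset_def by (intro extensionality) blast

end

section \<open>Evaluation of coded terms\<close>

text \<open>Operation labels are pairs of a symbol and a cover, so a code determines its cover and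
  thereby the index set of its arguments; \<open>Y\<close> is one set containing all these
  indices.\<close>

locale coded_signature = ZF_model +
  fixes Op Ar Eqs G C X P Y B vc oc :: 'a
  assumes Ar: "is_fun Ar Op C"
    and X_iff: "\<And>\<sigma> i. pr \<sigma> i \<^bold>\<in> X \<longleftrightarrow> \<sigma> \<^bold>\<in> Op \<and> i \<^bold>\<in> app Ar \<sigma>"
    and P_dom: "\<And>p D y. p \<^bold>\<in> P \<Longrightarrow> is_surj p D X \<Longrightarrow> y \<^bold>\<in> D \<Longrightarrow> y \<^bold>\<in> Y"
    and covers: "\<And>M x \<sigma>. \<lbrakk>\<sigma> \<^bold>\<in> Op; is_fun x (app Ar \<sigma>) M;
        \<And>i. i \<^bold>\<in> app Ar \<sigma> \<Longrightarrow> \<exists>t. t \<^bold>\<in> B \<and> t \<^bold>\<in> app x i\<rbrakk> \<Longrightarrow>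
      \<exists>p D f. p \<^bold>\<in> P \<and> is_surj p D X \<and> is_fun f D B \<and>
        (\<forall>y i. maps p y (pr \<sigma> i) \<longrightarrow> app f y \<^bold>\<in> app x i)"
    and vc: "is_fun vc G B"
    and oc: "is_fun oc (Times (Times Op P) (Power (Times Y B))) B"
    and vc_inj: "\<And>v v'. \<lbrakk>v \<^bold>\<in> G; v' \<^bold>\<in> G; app vc v = app vc v'\<rbrakk> \<Longrightarrow> v = v'"
    and vc_oc: "\<And>v l f. \<lbrakk>v \<^bold>\<in> G; l \<^bold>\<in> Times Op P; f \<^bold>\<in> Power (Times Y B)\<rbrakk> \<Longrightarrow>
        app vc v \<noteq> app oc (pr l f)"
    and oc_inj1: "\<And>l l' f f'. \<lbrakk>l \<^bold>\<in> Times Op P; l' \<^bold>\<in> Times Op P; f \<^bold>\<in> Power (Times Y B);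
        f' \<^bold>\<in> Power (Times Y B); app oc (pr l f) = app oc (pr l' f')\<rbrakk> \<Longrightarrow> l = l'"
    and oc_inj2: "\<And>l f f' D. \<lbrakk>l \<^bold>\<in> Times Op P; \<forall>y. y \<^bold>\<in> D \<longrightarrow> y \<^bold>\<in> Y; is_fun f D B; is_fun f' D B;
        app oc (pr l f) = app oc (pr l f')\<rbrakk> \<Longrightarrow> f = f'"
begin

lemma sig: "is_signature Op Ar"
  unfolding is_signature_def using Ar by blast

text \<open>\<open>node \<sigma> p D f\<close>: an argument family for \<open>\<sigma>\<close>, indexed by a cover \<open>p\<close> instead of the arity.\<close>

definition node :: "'a \<Rightarrow> 'a \<Rightarrow> 'a \<Rightarrow> 'a \<Rightarrow> bool" where
  "node \<sigma> p D f \<longleftrightarrow> \<sigma> \<^bold>\<in> Op \<and> p \<^bold>\<in> P \<and> is_surj p D X \<and> is_fun f D B"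

definition code :: "'a \<Rightarrow> 'a \<Rightarrow> 'a \<Rightarrow> 'a" where
  "code \<sigma> p f = app oc (pr (pr \<sigma> p) f)"

lemma node_Power: "node \<sigma> p D f \<Longrightarrow> f \<^bold>\<in> Power (Times Y B)"
  unfolding node_def mem_Power mem_Times is_fun_iff using P_dom by blast

lemma code_mem: "node \<sigma> p D f \<Longrightarrow> code \<sigma> p f \<^bold>\<in> B"
  unfolding code_def using node_Power
  by (intro app_mem[OF oc]) (simp add: node_def del: mem_Power)

lemma vc_neq_code: "v \<^bold>\<in> G \<Longrightarrow> node \<sigma> p D f \<Longrightarrow> app vc v \<noteq> code \<sigma> p f"
  unfolding code_def using node_Power
  by (intro vc_oc) (simp_all add: node_def del: mem_Power)

text \<open>The label yields symbol and cover; a cover has only one domain, so both families are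
  functions on the same set and \<open>oc_inj2\<close> applies.\<close>

lemma code_inj:
  assumes "node \<sigma> p D f" "node \<sigma>' p' D' f'" "code \<sigma> p f = code \<sigma>' p' f'"
  shows "\<sigma> = \<sigma>'" "p = p'" "f = f'"
proof -
  have n: "\<sigma> \<^bold>\<in> Op" "p \<^bold>\<in> P" "is_surj p D X" "is_fun f D B"
    "\<sigma>' \<^bold>\<in> Op" "p' \<^bold>\<in> P" "is_surj p' D' X" "is_fun f' D' B"
    using assms(1,2) unfolding node_def by auto
  have l: "pr \<sigma> p \<^bold>\<in> Times Op P" "pr \<sigma>' p' \<^bold>\<in> Times Op P" using n by simp_all
  note eq' = assms(3)[unfolded code_def]
  from oc_inj1[OF l node_Power[OF assms(1)] node_Power[OF assms(2)] eq']
  show eq: "\<sigma> = \<sigma>'" "p = p'" by simp_all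
  have "D = D'" using is_surjD(1) n(3,7) eq fun_dom_unique by metis
  have "\<forall>y. y \<^bold>\<in> D \<longrightarrow> y \<^bold>\<in> Y" using P_dom n(2,3) by blast
  then show "f = f'"
    using oc_inj2[OF l(1) _ n(4)] n(8) eq' unfolding eq \<open>D = D'\<close> by blast
qed

lemma node_cover: "node \<sigma> p D f \<Longrightarrow> i \<^bold>\<in> app Ar \<sigma> \<Longrightarrow> \<exists>y. maps p y (pr \<sigma> i) \<and> app f y \<^bold>\<in> B"
proof -
  assume n: "node \<sigma> p D f" and i: "i \<^bold>\<in> app Ar \<sigma>"
  have "pr \<sigma> i \<^bold>\<in> X" using n i unfolding node_def X_iff by blast
  moreover have p: "is_surj p D X" and f: "is_fun f D B" using n unfolding node_def by blast+
  ultimately obtain y where y: "maps p y (pr \<sigma> i)" using is_surjD(2) by blast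
  then have "y \<^bold>\<in> D" using maps_app[OF is_surjD(1)[OF p]] by blast
  with y show ?thesis using app_mem[OF f] by blast
qed

lemma node_index: "node \<sigma> p D f \<Longrightarrow> maps p y (pr \<sigma> i) \<Longrightarrow> i \<^bold>\<in> app Ar \<sigma>"
proof -
  assume n: "node \<sigma> p D f" and y: "maps p y (pr \<sigma> i)"
  have p: "is_fun p D X" using n is_surjD(1) unfolding node_def by blast
  have "y \<^bold>\<in> D" "pr \<sigma> i = app p y" using y unfolding maps_app[OF p] by blast+
  then have "pr \<sigma> i \<^bold>\<in> X" using app_mem[OF p] by simp
  then show "i \<^bold>\<in> app Ar \<sigma>" unfolding X_iff by blast
qed

definition galg :: "'a \<Rightarrow> 'a \<Rightarrow> 'a \<Rightarrow> bool" where
  "galg N H g \<longleftrightarrow> is_algebra Op Ar Eqs N H \<and> is_fun g G N"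

lemma galg_structure: "galg N H g \<Longrightarrow> is_structure Op Ar N H"
  unfolding galg_def is_algebra_def by blast

definition val_closed :: "'a \<Rightarrow> 'a \<Rightarrow> 'a \<Rightarrow> 'a \<Rightarrow> bool" where
  "val_closed N H g R \<longleftrightarrow> (\<forall>v. v \<^bold>\<in> G \<longrightarrow> maps R (app vc v) (app g v)) \<and>
    (\<forall>\<sigma> p D f x. node \<sigma> p D f \<and> is_fun x (app Ar \<sigma>) N \<and>
      (\<forall>y i. maps p y (pr \<sigma> i) \<longrightarrow> maps R (app f y) (app x i)) \<longrightarrow>
      maps R (code \<sigma> p f) (app (app H \<sigma>) x))"

text \<open>
  The value of a code in \<open>(N, H)\<close>. It is partial: a code has no value when its arguments do not
  agree on the fibres of the cover.
\<close>

definition val :: "'a \<Rightarrow> 'a \<Rightarrow> 'a \<Rightarrow> 'a \<Rightarrow> 'a \<Rightarrow> bool" where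
  "val N H g t n \<longleftrightarrow> (\<forall>R. val_closed N H g R \<longrightarrow> maps R t n)"

lemma dfn_galg: "dft t \<Longrightarrow> dft u \<Longrightarrow> dft v \<Longrightarrow> dfn (\<lambda>e. galg (t e) (u e) (v e))"
  unfolding galg_def by (intro dfn_basic dfn_is_algebra dft_shift)

lemma dfn_val:
  "dft a \<Longrightarrow> dft b \<Longrightarrow> dft c \<Longrightarrow> dft t \<Longrightarrow> dft u \<Longrightarrow>
    dfn (\<lambda>e. val (a e) (b e) (c e) (t e) (u e))"
  unfolding val_def val_closed_def node_def code_def
  by (intro dfn_basic dft_pr dft_app dft_shift)

lemma val_var: "v \<^bold>\<in> G \<Longrightarrow> val N H g (app vc v) (app g v)"
  unfolding val_def val_closed_def by blast

lemma val_code: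
  assumes "node \<sigma> p D f" "is_fun x (app Ar \<sigma>) N"
    "\<And>y i. maps p y (pr \<sigma> i) \<Longrightarrow> val N H g (app f y) (app x i)"
  shows "val N H g (code \<sigma> p f) (app (app H \<sigma>) x)"
  unfolding val_def
proof (intro allI impI)
  fix R assume R: "val_closed N H g R"
  have "\<forall>y i. maps p y (pr \<sigma> i) \<longrightarrow> maps R (app f y) (app x i)"
    using assms(3) R unfolding val_def by blast
  with R assms(1,2) show "maps R (code \<sigma> p f) (app (app H \<sigma>) x)"
    unfolding val_closed_def by blast
qed

text \<open>Leastness of \<open>val\<close> is applied to the pairs in \<open>Times B N\<close> that
  satisfy \<open>val\<close> and \<open>Q\<close>. The bound makes them a set, and closure of that
  set under the operations is where \<open>galg\<close> is used; membership of \<open>t\<close> and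
  \<open>n\<close> comes along.\<close>

lemma val_induct [consumes 2, case_names dfn var code]:
  assumes N: "galg N H g" and val: "val N H g t n"
    and Q: "dfn (\<lambda>e. Q (e (Suc 0)) (e 0))"
    and var: "\<And>v. v \<^bold>\<in> G \<Longrightarrow> Q (app vc v) (app g v)"
    and code: "\<And>\<sigma> p D f x. \<lbrakk>node \<sigma> p D f; is_fun x (app Ar \<sigma>) N;
      \<And>y i. maps p y (pr \<sigma> i) \<Longrightarrow> val N H g (app f y) (app x i);
      \<And>y i. maps p y (pr \<sigma> i) \<Longrightarrow> Q (app f y) (app x i)\<rbrakk> \<Longrightarrow>
      Q (code \<sigma> p f) (app (app H \<sigma>) x)"
  shows "Q t n" "t \<^bold>\<in> B" "n \<^bold>\<in> N"
proof -
  have "dfn (\<lambda>e. \<exists>t n. e 0 = pr t n \<and> val N H g t n \<and> Q t n)"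
    by (intro dfn_basic dft_pr dfn_val Q)
  then obtain R where R: "\<And>w. w \<^bold>\<in> R \<longleftrightarrow> w \<^bold>\<in> Times B N \<and>
      (\<exists>t n. w = pr t n \<and> val N H g t n \<and> Q t n)"
    by (rule sep_ex) blast
  have R_iff: "maps R t n \<longleftrightarrow> t \<^bold>\<in> B \<and> n \<^bold>\<in> N \<and> val N H g t n \<and> Q t n" for t n
    unfolding maps_iff R by simp
  have g: "is_fun g G N" using N unfolding galg_def by blast
  have "val_closed N H g R"
    unfolding val_closed_def
  proof (intro conjI allI impI; (elim conjE)?)
    fix v assume v: "v \<^bold>\<in> G"
    then show "maps R (app vc v) (app g v)"
      unfolding R_iff using app_mem[OF vc v] app_mem[OF g v] val_var var by blast
  next
    fix \<sigma> p D f x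
    assume n: "node \<sigma> p D f" and x: "is_fun x (app Ar \<sigma>) N"
      and *: "\<forall>y i. maps p y (pr \<sigma> i) \<longrightarrow> maps R (app f y) (app x i)"
    have "\<sigma> \<^bold>\<in> Op" using n unfolding node_def by blast
    then have "app (app H \<sigma>) x \<^bold>\<in> N"
      using structure_op_maps(2)[OF sig galg_structure[OF N]] x by blast
    moreover have "val N H g (code \<sigma> p f) (app (app H \<sigma>) x)"
      by (rule val_code[OF n x]) (use * R_iff in blast)
    moreover have "Q (code \<sigma> p f) (app (app H \<sigma>) x)"
      by (rule code[OF n x]) (use * R_iff in blast)+
    ultimately show "maps R (code \<sigma> p f) (app (app H \<sigma>) x)"
      unfolding R_iff using code_mem[OF n] by blast
  qed
  then have "maps R t n" using val unfolding val_def by blast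
  then show "Q t n" "t \<^bold>\<in> B" "n \<^bold>\<in> N" unfolding R_iff by blast+
qed

lemma val_mem:
  assumes "galg N H g" "val N H g t n"
  shows "t \<^bold>\<in> B" "n \<^bold>\<in> N"
proof -
  have Q: "dfn (\<lambda>e. e 0 = e 0)" by (intro dfn_basic)
  show "t \<^bold>\<in> B" by (rule val_induct(2)[OF assms Q]) simp_all
  show "n \<^bold>\<in> N" by (rule val_induct(3)[OF assms Q]) simp_all
qed

lemma val_varD:
  assumes N: "galg N H g" and "val N H g (app vc v) n" "v \<^bold>\<in> G"
  shows "n = app g v"
proof -
  have Q: "dfn (\<lambda>e. e (Suc 0) = app vc v \<longrightarrow> e 0 = app g v)"
    by (intro dfn_basic dft_app)
  have "app vc v = app vc v \<longrightarrow> n = app g v"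
  proof (rule val_induct(1)[OF assms(1,2) Q])
    fix v' assume "v' \<^bold>\<in> G"
    then show "app vc v' = app vc v \<longrightarrow> app g v' = app g v" using vc_inj assms(3) by blast
  next
    fix \<sigma> p D f x assume "node \<sigma> p D f"
    then show "code \<sigma> p f = app vc v \<longrightarrow> app (app H \<sigma>) x = app g v"
      using vc_neq_code assms(3) by metis
  qed
  then show ?thesis by simp
qed

text \<open>Inversion rests on unique readability: the induction predicate assumes equality with the
  given code, so \<open>vc_neq_code\<close> rules out the variable case and \<open>code_inj\<close>
  identifies the other one.\<close>

lemma val_codeD:
  assumes N: "galg N H g" and val: "val N H g (code \<sigma> p f) n" and node: "node \<sigma> p D f"
  obtains x where "is_fun x (app Ar \<sigma>) N"
    "\<And>y i. maps p y (pr \<sigma> i) \<Longrightarrow> val N H g (app f y) (app x i)" "n = app (app H \<sigma>) x"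
proof -
  have Q: "dfn (\<lambda>e. e (Suc 0) = code \<sigma> p f \<longrightarrow> (\<exists>x. is_fun x (app Ar \<sigma>) N \<and>
      (\<forall>y i. maps p y (pr \<sigma> i) \<longrightarrow> val N H g (app f y) (app x i)) \<and> e 0 = app (app H \<sigma>) x))"
    by (intro dfn_basic dfn_val dft_pr dft_app)
  have "code \<sigma> p f = code \<sigma> p f \<longrightarrow> (\<exists>x. is_fun x (app Ar \<sigma>) N \<and>
      (\<forall>y i. maps p y (pr \<sigma> i) \<longrightarrow> val N H g (app f y) (app x i)) \<and> n = app (app H \<sigma>) x)"
  proof (rule val_induct(1)[OF N val Q], goal_cases)
    case (1 v)
    then show ?case using vc_neq_code node by metis
  next
    case (2 \<sigma>' p' D' f' x)
    show ?case
    proof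
      assume "code \<sigma>' p' f' = code \<sigma> p f"
      note eq = code_inj[OF 2(1) node this]
      show "\<exists>x'. is_fun x' (app Ar \<sigma>) N \<and> (\<forall>y i. maps p y (pr \<sigma> i) \<longrightarrow>
          val N H g (app f y) (app x' i)) \<and> app (app H \<sigma>') x = app (app H \<sigma>) x'"
        by (rule exI[of _ x]) (use 2(2,3) eq in simp)
    qed
  qed
  then show thesis using that by blast
qed

text \<open>Surjectivity of the cover is decisive: some point lies over each \<open>i\<close>, and
  by induction the code at that point has only one value, so two argument families agree at
  \<open>i\<close>.\<close>

lemma val_unique:
  assumes N: "galg N H g" and "val N H g t n" "val N H g t n'"
  shows "n' = n"
proof -
  have Q: "dfn (\<lambda>e. \<forall>n'. val N H g (e (Suc 0)) n' \<longrightarrow> n' = e 0)"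
    by (intro dfn_basic dfn_val)
  have "\<forall>n'. val N H g t n' \<longrightarrow> n' = n"
  proof (rule val_induct(1)[OF assms(1,2) Q], goal_cases)
    case (1 v)
    then show ?case using val_varD[OF N] by blast
  next
    case (2 \<sigma> p D f x)
    show ?case
    proof (intro allI impI)
      fix n' assume "val N H g (code \<sigma> p f) n'"
      then obtain x' where x': "is_fun x' (app Ar \<sigma>) N" "n' = app (app H \<sigma>) x'"
        "\<And>y i. maps p y (pr \<sigma> i) \<Longrightarrow> val N H g (app f y) (app x' i)"
        using val_codeD[OF N _ 2(1)] by metis
      have "x' = x"
      proof (rule fun_eqI[OF x'(1) 2(2)])
        fix i assume "i \<^bold>\<in> app Ar \<sigma>"
        then obtain y where "maps p y (pr \<sigma> i)" using node_cover[OF 2(1)] by blast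
        with 2(4) x'(3) show "app x' i = app x i" by blast
      qed
      with x'(2) show "n' = app (app H \<sigma>) x" by simp
    qed
  qed
  with assms(3) show ?thesis by blast
qed

section \<open>The quotient and its universal property\<close>

definition total :: "'a \<Rightarrow> bool" where
  "total t \<longleftrightarrow> t \<^bold>\<in> B \<and> (\<forall>N H g. galg N H g \<longrightarrow> (\<exists>n. val N H g t n))"

text \<open>An equivalence relation by its form; for total codes, whose values are unique, it says
  that the values coincide in every algebra.\<close>

definition eqv :: "'a \<Rightarrow> 'a \<Rightarrow> bool" where
  "eqv s t \<longleftrightarrow> (\<forall>N H g n. galg N H g \<longrightarrow> (val N H g s n \<longleftrightarrow> val N H g t n))"

definition is_class :: "'a \<Rightarrow> bool" where
  "is_class c \<longleftrightarrow> (\<exists>t. total t \<and> (\<forall>s. s \<^bold>\<in> c \<longleftrightarrow> total s \<and> eqv s t))"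

definition M :: 'a where
  "M = (SOME M. \<forall>c. c \<^bold>\<in> M \<longleftrightarrow> is_class c)"

lemma dfn_total: "dft t \<Longrightarrow> dfn (\<lambda>e. total (t e))"
  unfolding total_def by (intro dfn_basic dfn_galg dfn_val dft_shift)

lemma dfn_eqv: "dft t \<Longrightarrow> dft u \<Longrightarrow> dfn (\<lambda>e. eqv (t e) (u e))"
  unfolding eqv_def by (intro dfn_basic dfn_galg dfn_val dft_shift)

lemma mem_M: "c \<^bold>\<in> M \<longleftrightarrow> is_class c"
proof -
  have "dfn (\<lambda>e. is_class (e 0))"
    unfolding is_class_def by (intro dfn_basic dfn_total dfn_eqv)
  then obtain u where u: "\<And>c. c \<^bold>\<in> u \<longleftrightarrow> c \<^bold>\<in> Power B \<and> is_class c"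
    by (rule sep_ex) blast
  have "c \<^bold>\<in> Power B" if "is_class c" for c
    using that unfolding is_class_def mem_Power total_def by blast
  with u have "\<exists>M. \<forall>c. c \<^bold>\<in> M \<longleftrightarrow> is_class c" by blast
  from someI_ex[OF this] show ?thesis unfolding M_def by blast
qed

lemma class_ex:
  assumes "total t"
  obtains c where "c \<^bold>\<in> M" "t \<^bold>\<in> c"
proof -
  have "dfn (\<lambda>e. total (e 0) \<and> eqv (e 0) t)" by (intro dfn_basic dfn_total dfn_eqv)
  then obtain c where c: "\<And>s. s \<^bold>\<in> c \<longleftrightarrow> s \<^bold>\<in> B \<and> total s \<and> eqv s t"
    by (rule sep_ex) blast
  have "c \<^bold>\<in> M" unfolding mem_M is_class_def
    using assms c by (intro exI[of _ t]) (auto simp: total_def)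
  moreover have "t \<^bold>\<in> c" using c assms by (auto simp: total_def eqv_def)
  ultimately show thesis using that by blast
qed

lemma eqv_refl: "eqv t t"
  unfolding eqv_def by simp

lemma eqv_sym: "eqv s t \<Longrightarrow> eqv t s"
  unfolding eqv_def by simp

lemma eqv_trans: "eqv s t \<Longrightarrow> eqv t u \<Longrightarrow> eqv s u"
  unfolding eqv_def by simp

lemma class_nonempty: "c \<^bold>\<in> M \<Longrightarrow> \<exists>t. t \<^bold>\<in> c"
  unfolding mem_M is_class_def using eqv_refl by blast

lemma class_total: "c \<^bold>\<in> M \<Longrightarrow> t \<^bold>\<in> c \<Longrightarrow> total t"
  unfolding mem_M is_class_def by blast

lemma class_eqv: "c \<^bold>\<in> M \<Longrightarrow> s \<^bold>\<in> c \<Longrightarrow> t \<^bold>\<in> c \<Longrightarrow> eqv s t"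
  unfolding mem_M is_class_def using eqv_sym eqv_trans by blast

lemma mem_class_iff: "c \<^bold>\<in> M \<Longrightarrow> t \<^bold>\<in> c \<Longrightarrow> s \<^bold>\<in> c \<longleftrightarrow> total s \<and> eqv s t"
  unfolding mem_M is_class_def using eqv_sym eqv_trans by blast

definition cval :: "'a \<Rightarrow> 'a \<Rightarrow> 'a \<Rightarrow> 'a \<Rightarrow> 'a \<Rightarrow> bool" where
  "cval N H g c n \<longleftrightarrow> (\<exists>t. t \<^bold>\<in> c \<and> val N H g t n)"

lemma dfn_cval:
  "dft a \<Longrightarrow> dft b \<Longrightarrow> dft c \<Longrightarrow> dft t \<Longrightarrow> dft u \<Longrightarrow>
    dfn (\<lambda>e. cval (a e) (b e) (c e) (t e) (u e))"
  unfolding cval_def by (intro dfn_basic dfn_val dft_shift)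

lemma cval_iff: "c \<^bold>\<in> M \<Longrightarrow> t \<^bold>\<in> c \<Longrightarrow> galg N H g \<Longrightarrow> cval N H g c n \<longleftrightarrow> val N H g t n"
  using class_eqv[of c t] unfolding cval_def eqv_def by blast

lemma cval_ex1:
  assumes "c \<^bold>\<in> M" "galg N H g"
  shows "\<exists>!n. n \<^bold>\<in> N \<and> cval N H g c n"
proof -
  obtain t where t: "t \<^bold>\<in> c" using class_nonempty assms by blast
  then obtain n where n: "val N H g t n"
    using class_total assms unfolding total_def by blast
  show ?thesis
    unfolding cval_iff[OF assms(1) t assms(2)]
    using n val_mem(2)[OF assms(2) n] val_unique[OF assms(2)] by blast
qed

lemma cval_unique: "c \<^bold>\<in> M \<Longrightarrow> galg N H g \<Longrightarrow> cval N H g c n \<Longrightarrow> cval N H g c n' \<Longrightarrow> n = n'"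
proof -
  assume c: "c \<^bold>\<in> M" and N: "galg N H g" and *: "cval N H g c n" "cval N H g c n'"
  obtain t where "t \<^bold>\<in> c" using class_nonempty[OF c] ..
  with * show "n = n'" using val_unique[OF N] cval_iff[OF c _ N] by blast
qed

text \<open>Evaluations jointly separate classes. One implication suffices because each class has
  exactly one value in every algebra.\<close>

lemma class_eqI:
  assumes c: "c \<^bold>\<in> M" "c' \<^bold>\<in> M"
    and *: "\<And>N H g n. galg N H g \<Longrightarrow> cval N H g c n \<Longrightarrow> cval N H g c' n"
  shows "c = c'"
proof -
  obtain t t' where t: "t \<^bold>\<in> c" "t' \<^bold>\<in> c'" using class_nonempty c by blast
  have "eqv t t'"
    unfolding eqv_def
  proof (intro allI impI)
    fix N H g n assume N: "galg N H g"
    have "cval N H g c n \<longleftrightarrow> cval N H g c' n"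
      using *[OF N] cval_ex1[OF c(1) N] cval_unique[OF c(2) N] by blast
    then show "val N H g t n \<longleftrightarrow> val N H g t' n"
      unfolding cval_iff[OF c(1) t(1) N] cval_iff[OF c(2) t(2) N] .
  qed
  then have "s \<^bold>\<in> c \<longleftrightarrow> s \<^bold>\<in> c'" for s
    using mem_class_iff[OF c(1) t(1)] mem_class_iff[OF c(2) t(2)] eqv_sym eqv_trans by metis
  then show ?thesis by (intro extensionality) simp
qed

text \<open>
  Characterising the operations on classes through all the algebras at once makes homomorphy of
  evaluation and independence of the chosen cover immediate.
\<close>

definition op_val :: "'a \<Rightarrow> 'a \<Rightarrow> 'a \<Rightarrow> bool" where
  "op_val \<sigma> x m \<longleftrightarrow> (\<forall>N H g y. galg N H g \<and> is_fun y (app Ar \<sigma>) N \<and>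
    (\<forall>i. i \<^bold>\<in> app Ar \<sigma> \<longrightarrow> cval N H g (app x i) (app y i)) \<longrightarrow> cval N H g m (app (app H \<sigma>) y))"

lemma dfn_op_val: "dft t \<Longrightarrow> dft u \<Longrightarrow> dft v \<Longrightarrow> dfn (\<lambda>e. op_val (t e) (u e) (v e))"
  unfolding op_val_def by (intro dfn_basic dfn_galg dfn_cval dft_app dft_shift)

text \<open>Values of classes are unique, so the family of values is definable even though
  representatives are not chosen.\<close>

lemma cval_family:
  assumes "galg N H g" "is_fun x A M"
  obtains y where "is_fun y A N" "\<And>i. i \<^bold>\<in> A \<Longrightarrow> cval N H g (app x i) (app y i)"
proof -
  have "dfn (\<lambda>e. cval N H g (app x (e 0)) (e (Suc 0)))"
    by (intro dfn_basic dfn_cval dft_app)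
  moreover have "\<exists>!n. n \<^bold>\<in> N \<and> cval N H g (app x i) n" if "i \<^bold>\<in> A" for i
    using cval_ex1[OF app_mem[OF assms(2) that] assms(1)] .
  ultimately obtain y where "is_fun y A N" "\<And>i. i \<^bold>\<in> A \<Longrightarrow> cval N H g (app x i) (app y i)"
    by (rule fun_choice) blast+
  then show thesis by (rule that)
qed

text \<open>Here AMC replaces the choice of representatives of a family of classes.\<close>

lemma op_val_ex1:
  assumes \<sigma>: "\<sigma> \<^bold>\<in> Op" and x: "is_fun x (app Ar \<sigma>) M"
  shows "\<exists>!m. m \<^bold>\<in> M \<and> op_val \<sigma> x m"
proof -
  have "\<exists>t. t \<^bold>\<in> B \<and> t \<^bold>\<in> app x i" if "i \<^bold>\<in> app Ar \<sigma>" for i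
    using class_nonempty[OF app_mem[OF x that]] class_total[OF app_mem[OF x that]]
    unfolding total_def by blast
  from covers[OF \<sigma> x this] obtain p D f where f: "p \<^bold>\<in> P" "is_surj p D X" "is_fun f D B"
    "\<And>y i. maps p y (pr \<sigma> i) \<Longrightarrow> app f y \<^bold>\<in> app x i" by blast
  have node: "node \<sigma> p D f" unfolding node_def using \<sigma> f by blast
  \<comment> \<open>Every point over \<open>i\<close> carries a member of the class
    \<open>app x i\<close>, and members of one class share their value, so the arguments agree on
    fibres.\<close>
  have val: "val N H g (code \<sigma> p f) (app (app H \<sigma>) y)"
    if N: "galg N H g" and y: "is_fun y (app Ar \<sigma>) N"
      "\<And>i. i \<^bold>\<in> app Ar \<sigma> \<Longrightarrow> cval N H g (app x i) (app y i)" for N H g y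
  proof (rule val_code[OF node y(1)])
    fix z i assume z: "maps p z (pr \<sigma> i)"
    have i: "i \<^bold>\<in> app Ar \<sigma>" using node_index[OF node z] .
    show "val N H g (app f z) (app y i)"
      using y(2)[OF i] unfolding cval_iff[OF app_mem[OF x i] f(4)[OF z] N] .
  qed
  have "\<exists>n. val N H g (code \<sigma> p f) n" if N: "galg N H g" for N H g
    using cval_family[OF N x] val[OF N] by metis
  then have "total (code \<sigma> p f)"
    unfolding total_def using code_mem[OF node] by blast
  then obtain m where m: "m \<^bold>\<in> M" "code \<sigma> p f \<^bold>\<in> m" by (rule class_ex)
  have "op_val \<sigma> x m"
    unfolding op_val_def using val cval_iff[OF m] by blast
  \<comment> \<open>The condition \<open>op_val\<close> fixes the value in every algebra, hence the
    class, whichever cover was used to find it.\<close>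
  moreover have "m' = m''" if m': "m' \<^bold>\<in> M" "op_val \<sigma> x m'" and m'': "m'' \<^bold>\<in> M" "op_val \<sigma> x m''"
    for m' m''
  proof (rule class_eqI[OF m'(1) m''(1)])
    fix N H g n assume N: "galg N H g" and n: "cval N H g m' n"
    obtain y where y: "is_fun y (app Ar \<sigma>) N"
      "\<And>i. i \<^bold>\<in> app Ar \<sigma> \<Longrightarrow> cval N H g (app x i) (app y i)"
      by (rule cval_family[OF N x]) blast
    have *: "cval N H g m' (app (app H \<sigma>) y)" "cval N H g m'' (app (app H \<sigma>) y)"
      using m'(2) m''(2) N y unfolding op_val_def by blast+
    have "n = app (app H \<sigma>) y" by (rule cval_unique[OF m'(1) N n *(1)])
    with *(2) show "cval N H g m'' n" by simp
  qed
  ultimately show ?thesis using m(1) by blast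
qed

lemma operations_ex:
  obtains F where "is_structure Op Ar M F"
    "\<And>\<sigma> x. \<sigma> \<^bold>\<in> Op \<Longrightarrow> is_fun x (app Ar \<sigma>) M \<Longrightarrow> op_val \<sigma> x (app (app F \<sigma>) x)"
proof -
  \<comment> \<open>The function set is introduced by a quantifier over \<open>K\<close> because
    \<open>Funs\<close> applied to the variable arity has no definability rule.\<close>
  define R where "R \<sigma> k \<longleftrightarrow> (\<exists>K. is_funset K (app Ar \<sigma>) M \<and> is_fun k K M \<and>
    (\<forall>x. x \<^bold>\<in> K \<longrightarrow> op_val \<sigma> x (app k x)))" for \<sigma> k
  have R_iff: "R \<sigma> k \<longleftrightarrow> is_fun k (Funs (app Ar \<sigma>) M) M \<and>
    (\<forall>x. is_fun x (app Ar \<sigma>) M \<longrightarrow> op_val \<sigma> x (app k x))" for \<sigma> k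
    unfolding R_def is_funset_iff by auto
  \<comment> \<open>One bound for the operations of all symbols: arities are members of
    \<open>C\<close>, so every argument family is a subset of
    \<open>Times (Unions C) M\<close>.\<close>
  let ?K = "Power (Times (Power (Times (Unions C) M)) M)"
  have "\<exists>!k. k \<^bold>\<in> ?K \<and> R \<sigma> k" if \<sigma>: "\<sigma> \<^bold>\<in> Op" for \<sigma>
  proof -
    have "dfn (\<lambda>e. op_val \<sigma> (e 0) (e (Suc 0)))" by (intro dfn_basic dfn_op_val)
    moreover have "\<exists>!m. m \<^bold>\<in> M \<and> op_val \<sigma> x m" if "x \<^bold>\<in> Funs (app Ar \<sigma>) M" for x
      using op_val_ex1[OF \<sigma>] that by simp
    ultimately obtain k where k: "is_fun k (Funs (app Ar \<sigma>) M) M"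
      "\<And>x. x \<^bold>\<in> Funs (app Ar \<sigma>) M \<Longrightarrow> op_val \<sigma> x (app k x)"
      by (rule fun_choice) blast+
    have "R \<sigma> k" unfolding R_iff using k by simp
    moreover have "k \<^bold>\<in> ?K"
    proof -
      have "x \<^bold>\<in> Power (Times (Unions C) M)" if "is_fun x (app Ar \<sigma>) M" for x
        using that app_mem[OF Ar \<sigma>] unfolding mem_Power mem_Times mem_Unions is_fun_iff by blast
      then show ?thesis
        using k(1) unfolding is_fun_iff[of k] mem_Power[of k] mem_Times[of _ _ M] mem_Funs by blast
    qed
    moreover have "k' = k" if "R \<sigma> k'" for k'
    proof -
      have k': "is_fun k' (Funs (app Ar \<sigma>) M) M"
        "\<And>x. is_fun x (app Ar \<sigma>) M \<Longrightarrow> op_val \<sigma> x (app k' x)"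
        using that unfolding R_iff by blast+
      show ?thesis
      proof (rule fun_eqI[OF k'(1) k(1)])
        fix x assume x: "x \<^bold>\<in> Funs (app Ar \<sigma>) M"
        then have "is_fun x (app Ar \<sigma>) M" by simp
        with x show "app k' x = app k x"
          using op_val_ex1[OF \<sigma>, of x] k'(2) k(2)[of x] app_mem[OF k'(1) x] app_mem[OF k(1) x]
          by blast
      qed
    qed
    ultimately show ?thesis by blast
  qed
  moreover have "dfn (\<lambda>e. R (e 0) (e (Suc 0)))"
    unfolding R_def by (intro dfn_basic dfn_op_val dft_app)
  ultimately obtain F where F: "is_fun F Op ?K" "\<And>\<sigma>. \<sigma> \<^bold>\<in> Op \<Longrightarrow> R \<sigma> (app F \<sigma>)"
    using fun_choice[of R Op ?K] by blast
  show thesis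
    by (rule that[of F]) (use F in \<open>auto simp: R_iff is_structure_iff[OF sig]\<close>)
qed

section \<open>Equations in the quotient\<close>

text \<open>Evaluations of classes separate points and commute with the operations, so
  \<open>s\<close> and \<open>t\<close> agree in \<open>M\<close> once they agree in every algebra.
  The evaluation of terms in \<open>M\<close> itself has to be constructed; it is pinned down by its
  images in all the algebras.\<close>

lemma quotient_satisfies_eqn:
  assumes F: "is_structure Op Ar M F"
    and F_val: "\<And>\<sigma> x. \<sigma> \<^bold>\<in> Op \<Longrightarrow> is_fun x (app Ar \<sigma>) M \<Longrightarrow> op_val \<sigma> x (app (app F \<sigma>) x)"
    and e: "e \<^bold>\<in> Eqs" "is_eqn e V s t"
    and T: "is_term_set Op Ar V T" and st: "s \<^bold>\<in> T" "t \<^bold>\<in> T"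
    and \<rho>: "is_fun \<rho> V M"
  shows "\<exists>ev m. is_eval Op Ar M F V T \<rho> ev \<and> maps ev s m \<and> maps ev t m"
proof -
  \<comment> \<open>\<open>r\<close> is the image of the assignment \<open>\<rho>\<close> under the
    evaluation of classes in \<open>(N, H)\<close>.\<close>
  define compat where "compat N H g r \<longleftrightarrow> galg N H g \<and> is_fun r V N \<and>
    (\<forall>v. v \<^bold>\<in> V \<longrightarrow> cval N H g (app \<rho> v) (app r v))" for N H g r
  text \<open>\<open>good m u\<close>: in every algebra, \<open>m\<close> has the value that the term \<open>u\<close> should have.\<close>
  define good where "good m u \<longleftrightarrow> (\<forall>N H g r ev. compat N H g r \<and>
    is_eval Op Ar N H V T r ev \<longrightarrow> cval N H g m (app ev u))" for m u
  have dfn_good: "dfn (\<lambda>e. good (a e) (b e))" if "dft a" "dft b" for a b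
    unfolding good_def compat_def
    by (intro dfn_basic dfn_galg dfn_cval dfn_is_eval dft_app dft_shift that)
  have T_closed: "term_closed Op Ar V T" using T unfolding is_term_set_def by blast
  \<comment> \<open>The evaluation of terms in \<open>N\<close> comes from
    \<open>satisfies_eqn\<close> itself, which asserts its existence together with the
    equality.\<close>
  have eval: "\<exists>r ev. compat N H g r \<and> is_eval Op Ar N H V T r ev \<and> app ev s = app ev t"
    if N: "galg N H g" for N H g
  proof -
    obtain r where r: "is_fun r V N" "\<And>v. v \<^bold>\<in> V \<Longrightarrow> cval N H g (app \<rho> v) (app r v)"
      by (rule cval_family[OF N \<rho>]) blast
    have "satisfies_eqn Op Ar N H V s t"
      using N e unfolding galg_def is_algebra_def by blast
    then obtain ev m where ev: "is_eval Op Ar N H V T r ev" "maps ev s m" "maps ev t m"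
      using T r(1) unfolding satisfies_eqn_def by blast
    have "is_fun ev T N" using ev(1) unfolding is_eval_def by blast
    then have "app ev s = app ev t" using ev(2,3) maps_app by metis
    then show ?thesis using N r ev(1) unfolding compat_def by blast
  qed
  \<comment> \<open>By \<open>eval\<close>, the condition in \<open>good\<close> is nonvacuous in
    every algebra, so it fixes all values of \<open>m\<close>.\<close>
  have good_unique: "m = m'" if "m \<^bold>\<in> M" "m' \<^bold>\<in> M" "good m u" "good m' u" for m m' u
  proof (rule class_eqI[OF that(1,2)])
    fix N H g n assume N: "galg N H g" and n: "cval N H g m n"
    obtain r ev where ev: "compat N H g r" "is_eval Op Ar N H V T r ev" using eval[OF N] by blast
    then have *: "cval N H g m (app ev u)" "cval N H g m' (app ev u)"
      using that(3,4) unfolding good_def by blast+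
    have "n = app ev u" by (rule cval_unique[OF that(1) N n *(1)])
    with *(2) show "cval N H g m' n" by simp
  qed
  have eval_iff: "is_eval Op Ar N H V T r ev \<longleftrightarrow> is_fun ev T N \<and>
    (\<forall>v t. v \<^bold>\<in> V \<and> is_var t v \<longrightarrow> app ev t = app r v) \<and>
    (\<forall>\<sigma> f t x. \<sigma> \<^bold>\<in> Op \<and> is_fun f (app Ar \<sigma>) T \<and> is_optm t \<sigma> f \<and> is_fun x (app Ar \<sigma>) N \<and>
      (\<forall>i. i \<^bold>\<in> app Ar \<sigma> \<longrightarrow> app x i = app ev (app f i)) \<longrightarrow> app ev t = app (app H \<sigma>) x)"
    if "compat N H g r" for N H g r ev
    using is_eval_iff[OF sig galg_structure _ T_closed] that unfolding compat_def by blast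
  have good_var: "good (app \<rho> v) u" if "v \<^bold>\<in> V" "is_var u v" for v u
    unfolding good_def
  proof (intro allI impI, elim conjE)
    fix N H g r ev assume c: "compat N H g r" and "is_eval Op Ar N H V T r ev"
    then have "app ev u = app r v" using that unfolding eval_iff[OF c] by blast
    then show "cval N H g (app \<rho> v) (app ev u)" using c that(1) unfolding compat_def by simp
  qed
  have good_op: "good (app (app F \<sigma>) x) u"
    if \<sigma>: "\<sigma> \<^bold>\<in> Op" and f: "is_fun f (app Ar \<sigma>) T" and u: "is_optm u \<sigma> f"
      and x: "is_fun x (app Ar \<sigma>) M" "\<And>i. i \<^bold>\<in> app Ar \<sigma> \<Longrightarrow> good (app x i) (app f i)" for \<sigma> f u x
    unfolding good_def
  proof (intro allI impI, elim conjE)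
    fix N H g r ev assume c: "compat N H g r" and ev: "is_eval Op Ar N H V T r ev"
    have "is_fun ev T N" using ev unfolding is_eval_def by blast
    then obtain h where h: "is_fun h (app Ar \<sigma>) N"
      "\<And>i. i \<^bold>\<in> app Ar \<sigma> \<Longrightarrow> app h i = app ev (app f i)"
      using comp_ex[OF f] by blast
    have "cval N H g (app x i) (app h i)" if i: "i \<^bold>\<in> app Ar \<sigma>" for i
      using x(2)[OF i] c ev unfolding h(2)[OF i] good_def by blast
    then have "cval N H g (app (app F \<sigma>) x) (app (app H \<sigma>) h)"
      using F_val[OF \<sigma> x(1)] c h(1) unfolding op_val_def compat_def by blast
    moreover have "app ev u = app (app H \<sigma>) h"
      using ev \<sigma> f u h unfolding eval_iff[OF c] by blast
    ultimately show "cval N H g (app (app F \<sigma>) x) (app ev u)" by simp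
  qed
  \<comment> \<open>Term induction through leastness of \<open>T\<close>: the terms that admit a
    good class form a closed set.\<close>
  have "dfn (\<lambda>e. \<exists>m. m \<^bold>\<in> M \<and> good m (e 0))"
    by (intro dfn_basic dfn_good)
  then obtain T' where T': "\<And>u. u \<^bold>\<in> T' \<longleftrightarrow> u \<^bold>\<in> T \<and> (\<exists>m. m \<^bold>\<in> M \<and> good m u)"
    by (rule sep_ex) blast
  have dfn_good': "dfn (\<lambda>e. good (e (Suc 0)) (app f (e 0)))" for f
    by (intro dfn_good dft_app dft_var dft_const)
  have "term_closed Op Ar V T'"
    unfolding term_closed_def
  proof (intro conjI allI impI; elim conjE)
    fix v u assume v: "v \<^bold>\<in> V" "is_var u v"
    then have "u \<^bold>\<in> T" using T_closed unfolding term_closed_def by blast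
    with good_var[OF v] app_mem[OF \<rho> v(1)] show "u \<^bold>\<in> T'" unfolding T' by blast
  next
    fix \<sigma> a f u assume \<sigma>: "\<sigma> \<^bold>\<in> Op" and a: "maps Ar \<sigma> a" and fT': "is_fun f a T'"
      and u: "is_optm u \<sigma> f"
    have a_eq: "a = app Ar \<sigma>" using a unfolding maps_signature[OF sig] by blast
    have f: "is_fun f a T"
      by (rule is_fun_mono[OF fT']) (use app_mem[OF fT'] T' in blast)
    \<comment> \<open>Good classes are unique, so those of the arguments assemble into a family
      without choice.\<close>
    have "\<exists>!m. m \<^bold>\<in> M \<and> good m (app f i)" if "i \<^bold>\<in> a" for i
      using app_mem[OF fT' that] good_unique unfolding T' by blast
    then obtain x where x: "is_fun x a M" "\<And>i. i \<^bold>\<in> a \<Longrightarrow> good (app x i) (app f i)"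
      by (rule fun_choice[OF dfn_good']) blast+
    have "good (app (app F \<sigma>) x) u"
      by (rule good_op[OF \<sigma> f[unfolded a_eq] u]) (use x a_eq in simp_all)
    moreover have "app (app F \<sigma>) x \<^bold>\<in> M"
      using structure_op_maps(2)[OF sig F \<sigma>] x(1) a_eq by blast
    moreover have "u \<^bold>\<in> T" using T_closed \<sigma> a f u unfolding term_closed_def by blast
    ultimately show "u \<^bold>\<in> T'" unfolding T' by blast
  qed
  then have "u \<^bold>\<in> T'" if "u \<^bold>\<in> T" for u
    using T that unfolding is_term_set_def subset_def by blast
  then have "\<exists>!m. m \<^bold>\<in> M \<and> good m u" if "u \<^bold>\<in> T" for u
    using that good_unique unfolding T' by blast
  moreover have "dfn (\<lambda>e. good (e (Suc 0)) (e 0))" by (intro dfn_good dft_var)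
  ultimately obtain ev where ev: "is_fun ev T M" and ev_good: "\<And>u. u \<^bold>\<in> T \<Longrightarrow> good (app ev u) u"
    using fun_choice[of "\<lambda>u m. good m u" T M] by blast
  have "is_eval Op Ar M F V T \<rho> ev"
    unfolding is_eval_iff[OF sig F \<rho> T_closed]
  proof (intro conjI ev allI impI; elim conjE)
    fix v u assume v: "v \<^bold>\<in> V" "is_var u v"
    then have u: "u \<^bold>\<in> T" using T_closed unfolding term_closed_def by blast
    show "app ev u = app \<rho> v"
      by (rule good_unique[OF app_mem[OF ev u] app_mem[OF \<rho> v(1)] ev_good[OF u] good_var[OF v]])
  next
    fix \<sigma> f u x
    assume \<sigma>: "\<sigma> \<^bold>\<in> Op" and f: "is_fun f (app Ar \<sigma>) T" and u: "is_optm u \<sigma> f"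
      and x: "is_fun x (app Ar \<sigma>) M" "\<forall>i. i \<^bold>\<in> app Ar \<sigma> \<longrightarrow> app x i = app ev (app f i)"
    have "good (app x i) (app f i)" if i: "i \<^bold>\<in> app Ar \<sigma>" for i
      using ev_good[OF app_mem[OF f i]] x(2) i by simp
    then have *: "good (app (app F \<sigma>) x) u" by (rule good_op[OF \<sigma> f u x(1)])
    have uT: "u \<^bold>\<in> T"
      using T_closed \<sigma> f u unfolding term_closed_def maps_signature[OF sig] by blast
    show "app ev u = app (app F \<sigma>) x"
      by (rule good_unique[OF app_mem[OF ev uT] structure_op_maps(2)[OF sig F \<sigma> x(1)]
            ev_good[OF uT] *])
  qed
  moreover have "app ev s = app ev t"
  proof (rule class_eqI)
    show "app ev s \<^bold>\<in> M" "app ev t \<^bold>\<in> M" using app_mem[OF ev] st by blast+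
  next
    fix N H g n assume N: "galg N H g" and n: "cval N H g (app ev s) n"
    obtain r ev' where r: "compat N H g r" "is_eval Op Ar N H V T r ev'"
      and eq: "app ev' s = app ev' t" using eval[OF N] by blast
    have *: "cval N H g (app ev u) (app ev' u)" if "u \<^bold>\<in> T" for u
      using ev_good[OF that] r unfolding good_def by blast
    have "n = app ev' s" by (rule cval_unique[OF app_mem[OF ev st(1)] N n *[OF st(1)]])
    with *[OF st(2)] eq show "cval N H g (app ev t) n" by simp
  qed
  ultimately show ?thesis using st maps_app[OF ev] by metis
qed

section \<open>The universal property of the quotient\<close>

lemma quotient_free:
  assumes "is_theory Op Ar Eqs"
  shows "\<exists>M F \<eta>. is_free_algebra Op Ar Eqs G M F \<eta>"
proof -
  obtain F where F: "is_structure Op Ar M F"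
    and F_val: "\<And>\<sigma> x. \<sigma> \<^bold>\<in> Op \<Longrightarrow> is_fun x (app Ar \<sigma>) M \<Longrightarrow> op_val \<sigma> x (app (app F \<sigma>) x)"
    by (rule operations_ex) blast
  have "satisfies_eqn Op Ar M F V s t" if e: "e \<^bold>\<in> Eqs" "is_eqn e V s t" for e V s t
  proof -
    obtain V' s' t' T where T: "is_eqn e V' s' t'" "is_term_set Op Ar V' T" "s' \<^bold>\<in> T" "t' \<^bold>\<in> T"
      using assms e(1) unfolding is_theory_def by blast
    then have eq: "V' = V" "s' = s" "t' = t" using e(2) unfolding is_eqn_iff by auto
    show ?thesis
      unfolding satisfies_eqn_def
    proof (intro allI impI; elim conjE)
      fix T1 \<rho> assume T1: "is_term_set Op Ar V T1" and \<rho>: "is_fun \<rho> V M"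
      have "T = T1" using term_set_unique T(2) T1 unfolding eq by blast
      then show "\<exists>ev m. is_eval Op Ar M F V T1 \<rho> ev \<and> maps ev s m \<and> maps ev t m"
        using quotient_satisfies_eqn[OF F F_val e T1 _ _ \<rho>] T(3,4) unfolding eq by blast
    qed
  qed
  then have alg: "is_algebra Op Ar Eqs M F" unfolding is_algebra_def using F by blast

  have "dfn (\<lambda>e. app vc (e 0) \<^bold>\<in> e (Suc 0))" by (intro dfn_basic dft_app)
  moreover have "\<exists>!c. c \<^bold>\<in> M \<and> app vc v \<^bold>\<in> c" if v: "v \<^bold>\<in> G" for v
  proof -
    have "total (app vc v)" unfolding total_def using app_mem[OF vc v] val_var[OF v] by blast
    then obtain c where c: "c \<^bold>\<in> M" "app vc v \<^bold>\<in> c" by (rule class_ex)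
    have "c' = c" if c': "c' \<^bold>\<in> M" "app vc v \<^bold>\<in> c'" for c'
      by (rule class_eqI[OF c'(1) c(1)]) (use cval_iff[OF c'] cval_iff[OF c] in blast)
    with c show ?thesis by blast
  qed
  ultimately obtain \<eta> where \<eta>: "is_fun \<eta> G M" "\<And>v. v \<^bold>\<in> G \<Longrightarrow> app vc v \<^bold>\<in> app \<eta> v"
    by (rule fun_choice) blast+

  have "\<exists>!h. is_hom Op Ar M F N H h \<and> is_comp g h \<eta>"
    if "is_algebra Op Ar Eqs N H" "is_fun g G N" for N H g
  proof -
    have N: "galg N H g" unfolding galg_def using that by blast
    note NH = galg_structure[OF N]
    note hom_iff = is_hom_iff[OF sig F NH]
    have "dfn (\<lambda>e. cval N H g (e 0) (e (Suc 0)))" by (intro dfn_basic dfn_cval)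
    then obtain h where h: "is_fun h M N" and h_val: "\<And>c. c \<^bold>\<in> M \<Longrightarrow> cval N H g c (app h c)"
      by (rule fun_choice) (use cval_ex1[OF _ N] in blast)+
    have h_eq: "app h c = n" if "c \<^bold>\<in> M" "cval N H g c n" for c n
      by (rule cval_unique[OF that(1) N h_val[OF that(1)] that(2)])
    have "is_hom Op Ar M F N H h"
      unfolding hom_iff
    proof (intro conjI h allI impI; elim conjE)
      fix \<sigma> x y
      assume \<sigma>: "\<sigma> \<^bold>\<in> Op" and x: "is_fun x (app Ar \<sigma>) M" and y: "is_fun y (app Ar \<sigma>) N"
        "\<forall>i. i \<^bold>\<in> app Ar \<sigma> \<longrightarrow> app y i = app h (app x i)"
      have "cval N H g (app x i) (app y i)" if "i \<^bold>\<in> app Ar \<sigma>" for i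
        using h_val[OF app_mem[OF x that]] y(2) that by simp
      then have "cval N H g (app (app F \<sigma>) x) (app (app H \<sigma>) y)"
        using F_val[OF \<sigma> x] N y(1) unfolding op_val_def by blast
      then show "app h (app (app F \<sigma>) x) = app (app H \<sigma>) y"
        by (rule h_eq[OF structure_op_maps(2)[OF sig F \<sigma> x]])
    qed
    moreover have "is_comp g h \<eta>"
      unfolding is_comp_iff[OF \<eta>(1) h]
    proof (intro conjI that(2) allI impI)
      fix v assume v: "v \<^bold>\<in> G"
      have "cval N H g (app \<eta> v) (app g v)"
        unfolding cval_iff[OF app_mem[OF \<eta>(1) v] \<eta>(2)[OF v] N] by (rule val_var[OF v])
      then show "app g v = app h (app \<eta> v)" using h_eq[OF app_mem[OF \<eta>(1) v]] by simp
    qed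
    moreover have "h' = h" if hom: "is_hom Op Ar M F N H h'" and comp: "is_comp g h' \<eta>" for h'
    proof -
      have h': "is_fun h' M N" using hom unfolding hom_iff by blast
      have h'_op: "app h' (app (app F \<sigma>) x) = app (app H \<sigma>) y"
        if "\<sigma> \<^bold>\<in> Op" "is_fun x (app Ar \<sigma>) M" "is_fun y (app Ar \<sigma>) N"
          "\<And>i. i \<^bold>\<in> app Ar \<sigma> \<Longrightarrow> app y i = app h' (app x i)" for \<sigma> x y
        using hom that unfolding hom_iff by blast
      have h'_\<eta>: "app h' (app \<eta> v) = app g v" if "v \<^bold>\<in> G" for v
        using comp that unfolding is_comp_iff[OF \<eta>(1) h'] by simp
      \<comment> \<open>The classes containing \<open>t\<close> are quantified inside the predicate:
        a code with a value in \<open>N\<close> but not in some other algebra belongs to no class,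
        and the claim is then vacuous.\<close>
      have Q: "dfn (\<lambda>e. \<forall>c. c \<^bold>\<in> M \<and> e (Suc 0) \<^bold>\<in> c \<longrightarrow> app h' c = e 0)"
        by (intro dfn_basic dft_app)
      have *: "\<forall>c. c \<^bold>\<in> M \<and> t \<^bold>\<in> c \<longrightarrow> app h' c = n" if val: "val N H g t n" for t n
      proof (rule val_induct(1)[OF N val Q], goal_cases)
        case (1 v)
        show ?case
        proof (intro allI impI; elim conjE)
          fix c assume c: "c \<^bold>\<in> M" "app vc v \<^bold>\<in> c"
          have "c = app \<eta> v"
            by (rule class_eqI[OF c(1) app_mem[OF \<eta>(1) 1]])
              (use cval_iff[OF c] cval_iff[OF app_mem[OF \<eta>(1) 1] \<eta>(2)[OF 1]] in blast)
          then show "app h' c = app g v" using h'_\<eta>[OF 1] by simp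
        qed
      next
        case (2 \<sigma> p D f x)
        note node = 2(1)
        have \<sigma>: "\<sigma> \<^bold>\<in> Op" using node unfolding node_def by blast
        show ?case
        proof (intro allI impI; elim conjE)
          fix c assume c: "c \<^bold>\<in> M" "code \<sigma> p f \<^bold>\<in> c"
          \<comment> \<open>Membership in a class makes the code total. Inverting its value in each
            algebra gives values to all its arguments, depending only on the index under the
            point.\<close>
          have inv: "\<exists>n x. val N' H' g' (code \<sigma> p f) n \<and> is_fun x (app Ar \<sigma>) N' \<and>
              n = app (app H' \<sigma>) x \<and>
              (\<forall>y i. maps p y (pr \<sigma> i) \<longrightarrow> val N' H' g' (app f y) (app x i))"
            if N': "galg N' H' g'" for N' H' g'
          proof -
            have "\<exists>n. val N' H' g' (code \<sigma> p f) n"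
              using class_total[OF c] N' unfolding total_def by blast
            then obtain n where n: "val N' H' g' (code \<sigma> p f) n" ..
            show ?thesis by (rule val_codeD[OF N' n node]) (use n in blast)
          qed
          \<comment> \<open>Arguments over the same \<open>i\<close> have equal values in every
            algebra, so they determine one class and the argument family descends from the cover to
            the arity.\<close>
          have "\<exists>!m. m \<^bold>\<in> M \<and> (\<exists>y. maps p y (pr \<sigma> i) \<and> app f y \<^bold>\<in> m)"
            if i: "i \<^bold>\<in> app Ar \<sigma>" for i
          proof -
            obtain y where y: "maps p y (pr \<sigma> i)" "app f y \<^bold>\<in> B"
              using node_cover[OF node i] by blast
            have "total (app f y)" unfolding total_def using y inv by blast
            then obtain m where m: "m \<^bold>\<in> M" "app f y \<^bold>\<in> m" by (rule class_ex)
            have "m1 = m2" if m1: "m1 \<^bold>\<in> M" "maps p y1 (pr \<sigma> i)" "app f y1 \<^bold>\<in> m1"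
              and m2: "m2 \<^bold>\<in> M" "maps p y2 (pr \<sigma> i)" "app f y2 \<^bold>\<in> m2" for m1 y1 m2 y2
            proof (rule class_eqI[OF m1(1) m2(1)])
              fix N' H' g' n assume N': "galg N' H' g'" and n: "cval N' H' g' m1 n"
              obtain x' where x': "val N' H' g' (app f y1) (app x' i)"
                "val N' H' g' (app f y2) (app x' i)" using inv[OF N'] m1(2) m2(2) by blast
              have "n = app x' i"
                using n val_unique[OF N' x'(1)] unfolding cval_iff[OF m1(1,3) N'] by blast
              then show "cval N' H' g' m2 n"
                using x'(2) unfolding cval_iff[OF m2(1,3) N'] by simp
            qed
            with m y(1) show ?thesis by blast
          qed
          moreover have "dfn (\<lambda>e. \<exists>y. maps p y (pr \<sigma> (e 0)) \<and> app f y \<^bold>\<in> e (Suc 0))"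
            by (intro dfn_basic dft_app dft_pr)
          ultimately obtain z where z: "is_fun z (app Ar \<sigma>) M"
            "\<And>i. i \<^bold>\<in> app Ar \<sigma> \<Longrightarrow> \<exists>y. maps p y (pr \<sigma> i) \<and> app f y \<^bold>\<in> app z i"
            using fun_choice[of "\<lambda>i m. \<exists>y. maps p y (pr \<sigma> i) \<and> app f y \<^bold>\<in> m" "app Ar \<sigma>" M] by blast
          \<comment> \<open>Both sides have the same values in every algebra. Compatibility of
            \<open>h'\<close> with \<open>\<sigma>\<close> then computes \<open>h'\<close> on
            \<open>c\<close> from the classes \<open>app z i\<close>, to which the induction
            hypothesis applies.\<close>
          have "c = app (app F \<sigma>) z"
          proof (rule class_eqI[OF c(1) structure_op_maps(2)[OF sig F \<sigma> z(1)]])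
            fix N' H' g' n assume N': "galg N' H' g'" and n: "cval N' H' g' c n"
            obtain n' x' where x': "val N' H' g' (code \<sigma> p f) n'" "is_fun x' (app Ar \<sigma>) N'"
              "n' = app (app H' \<sigma>) x'"
              "\<And>y i. maps p y (pr \<sigma> i) \<Longrightarrow> val N' H' g' (app f y) (app x' i)"
              using inv[OF N'] by blast
            have "n = n'"
              using n val_unique[OF N' x'(1)] unfolding cval_iff[OF c N'] by blast
            have "cval N' H' g' (app z i) (app x' i)" if i: "i \<^bold>\<in> app Ar \<sigma>" for i
            proof -
              obtain y where "maps p y (pr \<sigma> i)" "app f y \<^bold>\<in> app z i" using z(2)[OF i] by blast
              then show ?thesis
                using x'(4) cval_iff[OF app_mem[OF z(1) i] _ N'] by blast
            qed
            then have "cval N' H' g' (app (app F \<sigma>) z) (app (app H' \<sigma>) x')"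
              using F_val[OF \<sigma> z(1)] N' x'(2) unfolding op_val_def by blast
            then show "cval N' H' g' (app (app F \<sigma>) z) n" using x'(3) \<open>n = n'\<close> by simp
          qed
          moreover have "app h' (app (app F \<sigma>) z) = app (app H \<sigma>) x"
          proof (rule h'_op[OF \<sigma> z(1) 2(2)])
            fix i assume i: "i \<^bold>\<in> app Ar \<sigma>"
            obtain y where "maps p y (pr \<sigma> i)" "app f y \<^bold>\<in> app z i" using z(2)[OF i] by blast
            then show "app x i = app h' (app z i)"
              using 2(4) app_mem[OF z(1) i] by metis
          qed
          ultimately show "app h' c = app (app H \<sigma>) x" by simp
        qed
      qed
      show ?thesis
      proof (rule fun_eqI[OF h' h])
        fix c assume c: "c \<^bold>\<in> M"
        obtain t where t: "t \<^bold>\<in> c" using class_nonempty[OF c] ..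
        have "val N H g t (app h c)" using h_val[OF c] unfolding cval_iff[OF c t N] .
        from *[OF this] c t show "app h' c = app h c" by blast
      qed
    qed
    ultimately show ?thesis by blast
  qed
  with alg \<eta>(1) have "is_free_algebra Op Ar Eqs G M F \<eta>"
    unfolding is_free_algebra_def by blast
  then show ?thesis by blast
qed

end

theorem corollary5p4:
  fixes mem :: "'v \<Rightarrow> 'v \<Rightarrow> bool"
  assumes "ZF_model mem"
  shows "set_universe.AMC mem \<longrightarrow>
    (\<forall>Op Ar Eqs G. set_universe.is_theory mem Op Ar Eqs \<longrightarrow>
      (\<exists>M F \<eta>. set_universe.is_free_algebra mem Op Ar Eqs G M F \<eta>))"
proof (intro impI allI)
  interpret ZF_model mem by (fact assms)
  fix Op Ar Eqs G
  assume AMC and Eqs: "is_theory Op Ar Eqs"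
  obtain C where Ar: "is_fun Ar Op C"
    using Eqs unfolding is_theory_def is_signature_def by blast
  show "\<exists>M F \<eta>. is_free_algebra Op Ar Eqs G M F \<eta>"
  \<comment> \<open>Covers come before codes because the labels are the pairs in
    \<open>Times Op P\<close> and the indices lie in \<open>Y\<close>. The lifting property
    \<open>cov\<close> is therefore stated for every nonempty \<open>B\<close> and specialised once
    \<open>B\<close> is known.\<close>
  proof (rule covers_ex[OF \<open>AMC\<close> Ar], rule codes_ex)
    fix X P Y
    assume X: "\<And>\<sigma> i. mem (pr \<sigma> i) X \<longleftrightarrow> mem \<sigma> Op \<and> mem i (app Ar \<sigma>)"
    and P: "\<And>p D y. mem p P \<Longrightarrow> is_surj p D X \<Longrightarrow> mem y D \<Longrightarrow> mem y Y"
    and cov: "\<And>B M x \<sigma>. \<lbrakk>\<exists>b. mem b B; mem \<sigma> Op; is_fun x (app Ar \<sigma>) M;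
        \<And>i. mem i (app Ar \<sigma>) \<Longrightarrow> \<exists>t. mem t B \<and> mem t (app x i)\<rbrakk> \<Longrightarrow>
      \<exists>p D f. mem p P \<and> is_surj p D X \<and> is_fun f D B \<and>
        (\<forall>y i. maps p y (pr \<sigma> i) \<longrightarrow> mem (app f y) (app x i))"
    fix B vc oc
    assume B: "\<exists>b. mem b B" and codes: "is_fun vc G B"
      "is_fun oc (Times (Times Op P) (Power (Times Y B))) B"
      "\<And>v v'. \<lbrakk>mem v G; mem v' G; app vc v = app vc v'\<rbrakk> \<Longrightarrow> v = v'"
      "\<And>v l f. \<lbrakk>mem v G; mem l (Times Op P); mem f (Power (Times Y B))\<rbrakk> \<Longrightarrow>
        app vc v \<noteq> app oc (pr l f)"
      "\<And>l l' f f'. \<lbrakk>mem l (Times Op P); mem l' (Times Op P); mem f (Power (Times Y B));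
        mem f' (Power (Times Y B)); app oc (pr l f) = app oc (pr l' f')\<rbrakk> \<Longrightarrow> l = l'"
      "\<And>l f f' D. \<lbrakk>mem l (Times Op P); \<forall>y. mem y D \<longrightarrow> mem y Y; is_fun f D B; is_fun f' D B;
        app oc (pr l f) = app oc (pr l f')\<rbrakk> \<Longrightarrow> f = f'"
    interpret coded_signature mem Op Ar Eqs G C X P Y B vc oc
      by unfold_locales (fact Ar X P cov[OF B] codes)+
    show ?thesis by (rule quotient_free[OF Eqs])
  qed
qed

end
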